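(* Let $(M,g)$ be a Chen-Teo AF gravitational instanton (with parameters $\kappa>0$ and $\tfrac12<\xi<\tfrac1{\sqrt2}$), let $K=\partial_\tau$, $\lambda=g(K,K)$, and let $$\alpha_+=-\frac{x+y}{(\nu-1)(\nu x+y)},\qquad \alpha_-=\frac{(x-y)(\nu x+y)(a_1-a_3xy)}{(\nu-1)H},\qquad \alpha_2=\frac{(x-y)(\nu x+y)}{(\nu-1)H}.$$ Then the self-dual form $\omega_+$ and the anti-self-dual forms $\omega_-$ and $\omega_2$ generated by these functions, $$\omega_+=\frac1\lambda\big(K\wedge d\alpha_++\star(K\wedge d\alpha_+)\big),\quad \omega_-=\frac1\lambda\big(K\wedge d\alpha_--\star(K\wedge d\alpha_-)\big),\quad \omega_2=\frac1\lambda\big(K\wedge d\alpha_2-\star(K\wedge d\alpha_2)\big),$$ have finite $L^2$ energy, i.e. $\int_M\omega\wedge\star\omega<\infty$ for $\omega\in\{\omega_+,\omega_-,\omega_2\}$.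
   Context: $K$ also denotes the metric-dual $1$-form $g(K,\cdot)$. The Chen-Teo instanton. Fix $\kappa>0$ and $\tfrac12<\xi<\tfrac{1}{\sqrt2}$. Put $\nu=-2\xi^2$, $x_1=-4\xi^3(1-\xi)$, $x_2=-\xi(1-2\xi+2\xi^2)$, $x_3=1-2\xi$ (so $x_1<x_2<x_3$), $P(u)=(u-x_1)(u-x_2)(u-x_3)=a_0+a_1u+a_2u^2+a_3u^3$ (so $a_3=1$; put $a_4=0$), $X=P(x)$, $Y=P(y)$, and $$F=y^2X-x^2Y,\qquad H=(\nu x+y)\big[(\nu x-y)(a_1-a_3xy)-2(1-\nu)a_0\big],$$ $$G=(\nu^2a_0+2\nu a_3y^3)X+(a_0-2\nu a_0-2\nu a_1x)Y.$$ On the chart with coordinates $(\tau,x,y,\phi)$, $x_1<y<x_2<x<x_3$, the metric is the Ricci-flat Riemannian metric $$g=\frac{F}{(x-y)H}\Big(d\tau+\frac{G}{F}d\phi\Big)^2+\frac{\kappa H}{(x-y)^3}\Big(\frac{dx^2}{X}-\frac{dy^2}{Y}-\frac{XY}{\kappa F}d\phi^2\Big),$$ so $\lambda=\frac{F}{(x-y)H}$. The orientation is the one for which $d\tau\wedge dy\wedge dx\wedge d\phi$ is positive. Let $\ell_I=\frac1{k_I}\big(b_I\partial_\tau+\partial_\phi\big)$, $I=1,2$, with $$k_1=\frac{(1-\xi)(1-2\xi)(1-2\xi^2)^2}{2\sqrt\kappa(1-2\xi+2\xi^2)},\qquad k_2=\frac{(1-2\xi)(1-2\xi^2)^2(1-2\xi+2\xi^2)}{8\sqrt\kappa(1-\xi)\xi^2},$$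 $$b_1=\frac{4\xi^3(-1+4\xi(1-\xi)^2(1+2\xi^2))}{1-2\xi(1-\xi)},\qquad b_2=\frac{\xi^2(1-2\xi(2-3\xi+10\xi^2-16\xi^3+8\xi^4))}{1-\xi},$$ and $\ell_3=\ell_1-\ell_2$. The $(\tau,\phi)$-plane is quotiented by the lattice for which $\ell_1,\ell_2$ generate $2\pi$-periodic flows forming an effective $T^2$-action. The chart is completed by adding the fixed loci over the edges of the rectangle $[x_2,x_3]\times[x_1,x_2]\ni(x,y)$ with the corner $(x_2,x_2)$ (infinity) removed: $\ell_1$ vanishes over $x=x_2$ and over $y=x_2$, $\ell_2$ vanishes over $y=x_1$, and $\ell_3$ vanishes over $x=x_3$. The result $(M,g)$ is a smooth complete Ricci-flat Riemannian manifold (Chen-Teo), diffeomorphic to $\mathbb{CP}^2\setminus S^1$. The functions $x,y$, and hence $\alpha_\pm,\alpha_2$, are smooth on $M$; $\omega_\pm,\omega_2$ are defined by the displayed formulas on the open set where $K\ne0$, whose complement has measure zero. *)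

theory Defs
  imports "HOL-Analysis.Analysis" "HOL-Computational_Algebra.Polynomial"
begin

section \<open>Exterior algebra on an oriented Euclidean 4-space, in components\<close>

text \<open>
  A covector is given by its components \<open>a $ i\<close>, a 2-form by the antisymmetric matrix
  \<open>\<beta> $ i $ j = \<beta>(e\<^sub>i, e\<^sub>j)\<close>, a 4-form by its value on \<open>(e\<^sub>1, e\<^sub>2, e\<^sub>3, e\<^sub>4)\<close>,
  and a metric by its Gram matrix. The frame \<open>(e\<^sub>1, e\<^sub>2, e\<^sub>3, e\<^sub>4)\<close> is positively oriented.
\<close>

definition tensor_prod :: "real^4 \<Rightarrow> real^4 \<Rightarrow> real^4^4" where
  "tensor_prod a b = (\<chi> i j. a $ i * b $ j)"

definition wedge_1_1 :: "real^4 \<Rightarrow> real^4 \<Rightarrow> real^4^4" where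
  "wedge_1_1 a b = tensor_prod a b - tensor_prod b a"

definition levi_civita :: "4 \<Rightarrow> 4 \<Rightarrow> 4 \<Rightarrow> 4 \<Rightarrow> real" where
  "levi_civita i j k l =
     det ((\<chi> r. axis (if r = 1 then i else if r = 2 then j else if r = 3 then k else l) 1) :: real^4^4)"

definition wedge_2_2 :: "real^4^4 \<Rightarrow> real^4^4 \<Rightarrow> real" where
  "wedge_2_2 \<beta> \<gamma> =
     (\<Sum>i\<in>UNIV. \<Sum>j\<in>UNIV. \<Sum>k\<in>UNIV. \<Sum>l\<in>UNIV. levi_civita i j k l * \<beta> $ i $ j * \<gamma> $ k $ l) / 4"

definition volume_form :: "real^4^4 \<Rightarrow> real" where
  "volume_form g = sqrt (det g)"

text \<open>The Hodge star on 2-forms, normalised by \<open>\<beta> \<and> \<star>\<gamma> = \<langle>\<beta>, \<gamma>\<rangle> vol\<close>: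
  both indices of the form are raised and the result is contracted with the volume form.\<close>

definition hodge_star :: "real^4^4 \<Rightarrow> real^4^4 \<Rightarrow> real^4^4" where
  "hodge_star g \<beta> = (\<chi> i j.
     (\<Sum>k\<in>UNIV. \<Sum>l\<in>UNIV. \<Sum>m\<in>UNIV. \<Sum>n\<in>UNIV.
        volume_form g * levi_civita k l i j * matrix_inv g $ k $ m * matrix_inv g $ l $ n * \<beta> $ m $ n) / 2)"

definition differential :: "(real^4 \<Rightarrow> real) \<Rightarrow> real^4 \<Rightarrow> real^4" where
  "differential f p = (\<chi> i. frechet_derivative f (at p) (axis i 1))"


section \<open>The Chen-Teo instanton\<close>

text \<open>
  A point of the coordinate space is a vector \<open>p\<close> whose entries are listed in the order
  \<open>(\<tau>, y, x, \<phi>)\<close>, so that the standard frame is positively oriented for the orientation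
  in which \<open>d\<tau> \<and> dy \<and> dx \<and> d\<phi>\<close> is positive.
\<close>

abbreviation ct_y :: "real^4 \<Rightarrow> real" where "ct_y p \<equiv> p $ 2"
abbreviation ct_x :: "real^4 \<Rightarrow> real" where "ct_x p \<equiv> p $ 3"

abbreviation d_\<tau> :: "real^4" where "d_\<tau> \<equiv> axis 1 1"
abbreviation d_y :: "real^4" where "d_y \<equiv> axis 2 1"
abbreviation d_x :: "real^4" where "d_x \<equiv> axis 3 1"
abbreviation d_\<phi> :: "real^4" where "d_\<phi> \<equiv> axis 4 1"

abbreviation partial_\<tau> :: "real^4" where "partial_\<tau> \<equiv> axis 1 1"
abbreviation partial_\<phi> :: "real^4" where "partial_\<phi> \<equiv> axis 4 1"

context
  fixes \<kappa> \<xi> :: real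
begin

definition ct_nu :: real where "ct_nu = - 2 * \<xi>^2"

definition ct_x1 :: real where "ct_x1 = - 4 * \<xi>^3 * (1 - \<xi>)"
definition ct_x2 :: real where "ct_x2 = - \<xi> * (1 - 2 * \<xi> + 2 * \<xi>^2)"
definition ct_x3 :: real where "ct_x3 = 1 - 2 * \<xi>"

definition ct_P :: "real poly" where
  "ct_P = [:- ct_x1, 1:] * [:- ct_x2, 1:] * [:- ct_x3, 1:]"

definition ct_a :: "nat \<Rightarrow> real" where "ct_a i = coeff ct_P i"

definition ct_X :: "real^4 \<Rightarrow> real" where "ct_X p = poly ct_P (ct_x p)"
definition ct_Y :: "real^4 \<Rightarrow> real" where "ct_Y p = poly ct_P (ct_y p)"

definition ct_F :: "real^4 \<Rightarrow> real" where
  "ct_F p = (ct_y p)^2 * ct_X p - (ct_x p)^2 * ct_Y p"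

definition ct_H :: "real^4 \<Rightarrow> real" where
  "ct_H p = (ct_nu * ct_x p + ct_y p) *
     ((ct_nu * ct_x p - ct_y p) * (ct_a 1 - ct_a 3 * ct_x p * ct_y p) - 2 * (1 - ct_nu) * ct_a 0)"

definition ct_G :: "real^4 \<Rightarrow> real" where
  "ct_G p = (ct_nu^2 * ct_a 0 + 2 * ct_nu * ct_a 3 * (ct_y p)^3) * ct_X p
     + (ct_a 0 - 2 * ct_nu * ct_a 0 - 2 * ct_nu * ct_a 1 * ct_x p) * ct_Y p"

definition ct_chart :: "(real^4) set" where
  "ct_chart = {p. ct_x1 < ct_y p \<and> ct_y p < ct_x2 \<and> ct_x2 < ct_x p \<and> ct_x p < ct_x3}"

definition ct_metric :: "real^4 \<Rightarrow> real^4^4" where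
  "ct_metric p =
     (let \<theta> = d_\<tau> + (ct_G p / ct_F p) *\<^sub>R d_\<phi> in
      (ct_F p / ((ct_x p - ct_y p) * ct_H p)) *\<^sub>R tensor_prod \<theta> \<theta>
      + (\<kappa> * ct_H p / (ct_x p - ct_y p)^3) *\<^sub>R
          ((1 / ct_X p) *\<^sub>R tensor_prod d_x d_x - (1 / ct_Y p) *\<^sub>R tensor_prod d_y d_y
           - (ct_X p * ct_Y p / (\<kappa> * ct_F p)) *\<^sub>R tensor_prod d_\<phi> d_\<phi>))"


subsection \<open>The manifold \<open>M\<close> and its Riemannian measure\<close>

definition ct_k1 :: real where
  "ct_k1 = (1 - \<xi>) * (1 - 2 * \<xi>) * (1 - 2 * \<xi>^2)^2 / (2 * sqrt \<kappa> * (1 - 2 * \<xi> + 2 * \<xi>^2))"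

definition ct_k2 :: real where
  "ct_k2 = (1 - 2 * \<xi>) * (1 - 2 * \<xi>^2)^2 * (1 - 2 * \<xi> + 2 * \<xi>^2) / (8 * sqrt \<kappa> * (1 - \<xi>) * \<xi>^2)"

definition ct_b1 :: real where
  "ct_b1 = 4 * \<xi>^3 * (- 1 + 4 * \<xi> * (1 - \<xi>)^2 * (1 + 2 * \<xi>^2)) / (1 - 2 * \<xi> * (1 - \<xi>))"

definition ct_b2 :: real where
  "ct_b2 = \<xi>^2 * (1 - 2 * \<xi> * (2 - 3 * \<xi> + 10 * \<xi>^2 - 16 * \<xi>^3 + 8 * \<xi>^4)) / (1 - \<xi>)"

definition ct_l1 :: "real^4" where
  "ct_l1 = (1 / ct_k1) *\<^sub>R (ct_b1 *\<^sub>R partial_\<tau> + partial_\<phi>)"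

definition ct_l2 :: "real^4" where
  "ct_l2 = (1 / ct_k2) *\<^sub>R (ct_b2 *\<^sub>R partial_\<tau> + partial_\<phi>)"

definition ct_l3 :: "real^4" where "ct_l3 = ct_l1 - ct_l2"

definition ct_region :: "(real^4) set" where
  "ct_region = {p. ct_x1 \<le> ct_y p \<and> ct_y p \<le> ct_x2 \<and> ct_x2 \<le> ct_x p \<and> ct_x p \<le> ct_x3
     \<and> \<not> (ct_x p = ct_x2 \<and> ct_y p = ct_x2)}"

text \<open>The generators of the torus action that vanish over the point \<open>(x, y)\<close> of the rectangle.\<close>

definition ct_vanishing :: "real^4 \<Rightarrow> (real^4) set" where
  "ct_vanishing p =
     {v. v = ct_l1 \<and> (ct_x p = ct_x2 \<or> ct_y p = ct_x2)} \<union>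
     {v. v = ct_l2 \<and> ct_y p = ct_x1} \<union>
     {v. v = ct_l3 \<and> ct_x p = ct_x3}"

text \<open>
  Points are identified when they differ by an element of the period lattice
  \<open>2\<pi>\<int> \<ell>\<^sub>1 + 2\<pi>\<int> \<ell>\<^sub>2\<close> and, over the edges, by the flows of the vanishing generators.
\<close>

definition ct_rel :: "((real^4) \<times> (real^4)) set" where
  "ct_rel = {(p, q). p \<in> ct_region \<and> q \<in> ct_region \<and>
     (\<exists>m n :: int. q - p - (2 * pi * of_int m) *\<^sub>R ct_l1 - (2 * pi * of_int n) *\<^sub>R ct_l2
        \<in> span (ct_vanishing p))}"

definition ct_M :: "(real^4) set set" where
  "ct_M = ct_region // ct_rel"

definition ct_proj :: "real^4 \<Rightarrow> (real^4) set" where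
  "ct_proj p = ct_rel `` {p}"

definition ct_open_sets :: "(real^4) set set set" where
  "ct_open_sets = {U. U \<subseteq> ct_M \<and> openin (top_of_set ct_region) {p \<in> ct_region. ct_proj p \<in> U}}"

definition ct_fundamental_domain :: "(real^4) set" where
  "ct_fundamental_domain = {p \<in> ct_chart. \<exists>s t. 0 \<le> s \<and> s < 2 * pi \<and> 0 \<le> t \<and> t < 2 * pi \<and>
     p = s *\<^sub>R ct_l1 + t *\<^sub>R ct_l2 + ct_y p *\<^sub>R axis 2 1 + ct_x p *\<^sub>R axis 3 1}"

text \<open>
  The Riemannian measure on the Borel sets of \<open>M\<close>: the density \<open>sqrt (det g)\<close> on one period
  cell of the chart, transported to \<open>M\<close>. The fixed loci added over the edges are null sets.
\<close>

definition ct_volume :: "(real^4) set measure" where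
  "ct_volume = distr
     (density (restrict_space lborel ct_fundamental_domain) (\<lambda>p. ennreal (volume_form (ct_metric p))))
     (sigma ct_M ct_open_sets) ct_proj"

text \<open>
  An invariant function given on the chart, as a function on \<open>M\<close>; it is set to \<open>0\<close> on the null
  set of points that do not come from the chart.
\<close>

definition ct_descend :: "(real^4 \<Rightarrow> real) \<Rightarrow> (real^4) set \<Rightarrow> real" where
  "ct_descend f m =
     (if m \<inter> ct_chart \<noteq> {} then f (SOME p. p \<in> m \<inter> ct_chart) else 0)"


subsection \<open>The forms\<close>

definition ct_K :: "real^4" where "ct_K = partial_\<tau>"

definition ct_K_flat :: "real^4 \<Rightarrow> real^4" where "ct_K_flat p = ct_metric p *v ct_K"

definition ct_lambda :: "real^4 \<Rightarrow> real" where
  "ct_lambda p = ct_K \<bullet> (ct_metric p *v ct_K)"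

definition ct_alpha_plus :: "real^4 \<Rightarrow> real" where
  "ct_alpha_plus p = - (ct_x p + ct_y p) / ((ct_nu - 1) * (ct_nu * ct_x p + ct_y p))"

definition ct_alpha_minus :: "real^4 \<Rightarrow> real" where
  "ct_alpha_minus p =
     (ct_x p - ct_y p) * (ct_nu * ct_x p + ct_y p) * (ct_a 1 - ct_a 3 * ct_x p * ct_y p)
       / ((ct_nu - 1) * ct_H p)"

definition ct_alpha_two :: "real^4 \<Rightarrow> real" where
  "ct_alpha_two p = (ct_x p - ct_y p) * (ct_nu * ct_x p + ct_y p) / ((ct_nu - 1) * ct_H p)"

definition ct_sd_form :: "(real^4 \<Rightarrow> real) \<Rightarrow> real^4 \<Rightarrow> real^4^4" where
  "ct_sd_form \<alpha> p =
     (let \<beta> = wedge_1_1 (ct_K_flat p) (differential \<alpha> p)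
      in (1 / ct_lambda p) *\<^sub>R (\<beta> + hodge_star (ct_metric p) \<beta>))"

definition ct_asd_form :: "(real^4 \<Rightarrow> real) \<Rightarrow> real^4 \<Rightarrow> real^4^4" where
  "ct_asd_form \<alpha> p =
     (let \<beta> = wedge_1_1 (ct_K_flat p) (differential \<alpha> p)
      in (1 / ct_lambda p) *\<^sub>R (\<beta> - hodge_star (ct_metric p) \<beta>))"

definition ct_omega_plus :: "real^4 \<Rightarrow> real^4^4" where
  "ct_omega_plus = ct_sd_form ct_alpha_plus"

definition ct_omega_minus :: "real^4 \<Rightarrow> real^4^4" where
  "ct_omega_minus = ct_asd_form ct_alpha_minus"

definition ct_omega_two :: "real^4 \<Rightarrow> real^4^4" where
  "ct_omega_two = ct_asd_form ct_alpha_two"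

text \<open>
  The integral over \<open>M\<close> of the 4-form \<open>\<omega> \<and> \<star>\<omega> = f vol\<close> is the integral of \<open>f\<close> against the
  Riemannian measure. Only forms \<open>\<omega>\<close> invariant under \<open>\<partial>\<^sub>\<tau>\<close> and \<open>\<partial>\<^sub>\<phi>\<close> are meant.
\<close>

definition ct_energy_density :: "(real^4 \<Rightarrow> real^4^4) \<Rightarrow> (real^4) set \<Rightarrow> real" where
  "ct_energy_density \<omega> =
     ct_descend (\<lambda>p. wedge_2_2 (\<omega> p) (hodge_star (ct_metric p) (\<omega> p)) / volume_form (ct_metric p))"

definition ct_finite_energy :: "(real^4 \<Rightarrow> real^4^4) \<Rightarrow> bool" where
  "ct_finite_energy \<omega> \<longleftrightarrow> integrable ct_volume (ct_energy_density \<omega>)"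

end

end

theory Submission
  imports Defs
begin

text \<open>
  The energy of each form reduces to an explicit integral over the rectangle
  \<open>(x\<^sub>2, x\<^sub>3) \<times> (x\<^sub>1, x\<^sub>2)\<close> of the coordinates \<open>(x, y)\<close>, whose integrand is
  bounded except near the corner \<open>(x\<^sub>2, x\<^sub>2)\<close>, which is infinity, and has an integrable singularity there.

  Write \<open>\<beta> = K \<and> d\<alpha>\<close>. As \<open>\<beta> \<and> \<beta> = 0\<close> and \<open>d\<alpha>(K) = 0\<close>, the form \<open>\<omega> = (\<beta> \<plusminus> \<star>\<beta>) / \<lambda>\<close> has
  \<open>|\<omega>|\<^sup>2 = 2 |\<beta>|\<^sup>2 / \<lambda>\<^sup>2 = 2 |d\<alpha>|\<^sup>2 / \<lambda>\<close> (\<open>energy_density_torus_form\<close>). The determinant of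
  the metric is the square of \<open>\<kappa> H / (x - y)^5\<close>, and the product of density and volume is
  \<open>2 (-H) (Y \<alpha>\<^sub>y\<^sup>2 - X \<alpha>\<^sub>x\<^sup>2) / ((-F) (x - y))\<close>,
  where \<open>X, F, H < 0 < Y\<close>. All roots \<open>x\<^sub>i\<close> are negative, so \<open>x\<^sup>2\<close> and \<open>y\<^sup>2\<close> are at least \<open>x\<^sub>3\<^sup>2\<close> and
  \<open>-F = x\<^sup>2 Y - y\<^sup>2 X \<ge> x\<^sub>3\<^sup>2 (Y - X)\<close>. This absorbs the numerator as soon as the partial
  derivatives of \<open>\<alpha>\<close> are bounded, and leaves a multiple of
  \<open>1 / (x - y) \<le> 1 / (sqrt (x - x\<^sub>2) * sqrt (x\<^sub>2 - y))\<close>, which is integrable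
  (\<open>energy_integrand_bound\<close>, \<open>integrable_energy_integrand\<close>).

  It remains to see that the three functions \<open>\<alpha>\<close> are continuously differentiable up to the boundary.
  After cancelling \<open>\<nu> x + y\<close> they are quotients of polynomials whose denominators are multiples of
  \<open>\<nu> x + y\<close> or of \<open>Q = H / (\<nu> x + y)\<close>. The first is negative because \<open>-1 < \<nu> < 0\<close>. The second is
  concave in \<open>x\<close> and in \<open>y\<close> separately, so it is positive on the closed rectangle once it is
  positive at the four corners, where it factors (\<open>Q_pos_corners\<close>, \<open>Q_pos\<close>).

  On the side of the measure, an invariant function on \<open>M\<close> factors through the continuous map
  \<open>M \<rightarrow> \<real>\<^sup>2\<close> given by \<open>(x, y)\<close>, which makes the density Borel on \<open>M\<close>. A period cell of the chart is
  bounded in \<open>\<tau>\<close> and \<open>\<phi>\<close>, so that the integral over it is controlled by a product of four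
  one-dimensional integrals.
\<close>

section \<open>Two-forms adapted to a torus-symmetric metric\<close>

lemma det_4:
  "det (A::real^4^4) =
     A$1$1 * (A$2$2 * A$3$3 * A$4$4 + A$2$3 * A$3$4 * A$4$2 + A$2$4 * A$3$2 * A$4$3
       - A$2$2 * A$3$4 * A$4$3 - A$2$3 * A$3$2 * A$4$4 - A$2$4 * A$3$3 * A$4$2)
   - A$1$2 * (A$2$1 * A$3$3 * A$4$4 + A$2$3 * A$3$4 * A$4$1 + A$2$4 * A$3$1 * A$4$3
       - A$2$1 * A$3$4 * A$4$3 - A$2$3 * A$3$1 * A$4$4 - A$2$4 * A$3$3 * A$4$1)
   + A$1$3 * (A$2$1 * A$3$2 * A$4$4 + A$2$2 * A$3$4 * A$4$1 + A$2$4 * A$3$1 * A$4$2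
       - A$2$1 * A$3$4 * A$4$2 - A$2$2 * A$3$1 * A$4$4 - A$2$4 * A$3$2 * A$4$1)
   - A$1$4 * (A$2$1 * A$3$2 * A$4$3 + A$2$2 * A$3$3 * A$4$1 + A$2$3 * A$3$1 * A$4$2
       - A$2$1 * A$3$3 * A$4$2 - A$2$2 * A$3$1 * A$4$3 - A$2$3 * A$3$2 * A$4$1)"
proof -
  have f2: "finite {2::4, 3,4}" "1 \<notin> {2::4, 3,4}" by auto
  have f3: "finite {3::4,4}" "2 \<notin> {3::4,4}" by auto
  have f4: "finite {4::4}" "3 \<notin> {4::4}" by auto
  show ?thesis
    unfolding det_def UNIV_4
    unfolding sum_over_permutations_insert[OF f2]
    unfolding sum_over_permutations_insert[OF f3]
    unfolding sum_over_permutations_insert[OF f4]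
    unfolding permutes_sing
    by (simp add: sign_swap_id sign_compose permutation_compose permutation_swap_id sign_id
        transpose_eq_iff algebra_simps)
qed

lemma levi_civita_values:
  "levi_civita 1 2 3 4 = 1"
  "levi_civita 1 2 4 3 = -1"
  "levi_civita 1 3 2 4 = -1"
  "levi_civita 1 3 4 2 = 1"
  "levi_civita 1 4 2 3 = 1"
  "levi_civita 1 4 3 2 = -1"
  "levi_civita 2 1 3 4 = -1"
  "levi_civita 2 1 4 3 = 1"
  "levi_civita 2 3 1 4 = 1"
  "levi_civita 2 3 4 1 = -1"
  "levi_civita 2 4 1 3 = -1"
  "levi_civita 2 4 3 1 = 1"
  "levi_civita 3 1 2 4 = 1"
  "levi_civita 3 1 4 2 = -1"
  "levi_civita 3 2 1 4 = -1"
  "levi_civita 3 2 4 1 = 1"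
  "levi_civita 3 4 1 2 = 1"
  "levi_civita 3 4 2 1 = -1"
  "levi_civita 4 1 2 3 = -1"
  "levi_civita 4 1 3 2 = 1"
  "levi_civita 4 2 1 3 = 1"
  "levi_civita 4 2 3 1 = -1"
  "levi_civita 4 3 1 2 = -1"
  "levi_civita 4 3 2 1 = 1"
  by (simp_all add: levi_civita_def det_4 axis_def)

lemma levi_civita_repeated:
  "levi_civita i i k l = 0" "levi_civita i j i l = 0" "levi_civita i j k i = 0"
  "levi_civita i j j l = 0" "levi_civita i j k j = 0" "levi_civita i j k k = 0"
proof -
  have "levi_civita i j k l = 0" if "i = j \<or> i = k \<or> i = l \<or> j = k \<or> j = l \<or> k = l" for i j k l
  proof -
    have "\<exists>m n :: 4. m \<noteq> n \<and>
      (if m = 1 then i else if m = 2 then j else if m = 3 then k else l)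
      = (if n = 1 then i else if n = 2 then j else if n = 3 then k else l)"
      using that
      by (elim disjE)
        (rule exI[of _ 1] exI[of _ 2] exI[of _ 3],
          rule exI[of _ 2] exI[of _ 3] exI[of _ 4], simp; fail)+
    then show ?thesis
      unfolding levi_civita_def by (auto intro!: det_identical_rows simp: row_def)
  qed
  then show "levi_civita i i k l = 0" "levi_civita i j i l = 0" "levi_civita i j k i = 0"
    "levi_civita i j j l = 0" "levi_civita i j k j = 0" "levi_civita i j k k = 0"
    by simp_all
qed

lemmas levi_civita_simps = levi_civita_values levi_civita_repeated

text \<open>
  The span of \<open>d\<tau> \<and> dy\<close>, \<open>d\<tau> \<and> dx\<close>, \<open>dy \<and> d\<phi>\<close> and \<open>dx \<and> d\<phi>\<close> contains
  \<open>K \<and> d\<alpha>\<close> for every invariant \<open>\<alpha>\<close>. A metric without terms that mix \<open>(\<tau>, \<phi>)\<close> with \<open>(x, y)\<close>, and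
  diagonal in \<open>(x, y)\<close>, has a Hodge star that preserves this space, so all the forms that occur have
  these four components.
\<close>

definition torus_form :: "real \<Rightarrow> real \<Rightarrow> real \<Rightarrow> real \<Rightarrow> real^4^4" where
  "torus_form a b c d = a *\<^sub>R wedge_1_1 d_\<tau> d_y + b *\<^sub>R wedge_1_1 d_\<tau> d_x
     + c *\<^sub>R wedge_1_1 d_y d_\<phi> + d *\<^sub>R wedge_1_1 d_x d_\<phi>"

lemma torus_form_nth:
  "torus_form a b c d $ 1 $ 1 = 0" "torus_form a b c d $ 1 $ 2 = a"
  "torus_form a b c d $ 1 $ 3 = b" "torus_form a b c d $ 1 $ 4 = 0"
  "torus_form a b c d $ 2 $ 1 = - a" "torus_form a b c d $ 2 $ 2 = 0"
  "torus_form a b c d $ 2 $ 3 = 0" "torus_form a b c d $ 2 $ 4 = c"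
  "torus_form a b c d $ 3 $ 1 = - b" "torus_form a b c d $ 3 $ 2 = 0"
  "torus_form a b c d $ 3 $ 3 = 0" "torus_form a b c d $ 3 $ 4 = d"
  "torus_form a b c d $ 4 $ 1 = 0" "torus_form a b c d $ 4 $ 2 = - c"
  "torus_form a b c d $ 4 $ 3 = - d" "torus_form a b c d $ 4 $ 4 = 0"
  by (simp_all add: torus_form_def wedge_1_1_def tensor_prod_def axis_def)

lemma torus_form_linear:
  "torus_form a b c d + torus_form a' b' c' d' = torus_form (a + a') (b + b') (c + c') (d + d')"
  "s *\<^sub>R torus_form a b c d = torus_form (s * a) (s * b) (s * c) (s * d)"
  by (simp_all add: torus_form_def algebra_simps)

lemma wedge_torus_form:
  "wedge_2_2 (torus_form a b c d) (torus_form a' b' c' d') = a * d' - b * c' - c * b' + d * a'"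
  by (simp add: wedge_2_2_def sum_4 levi_civita_simps torus_form_nth)

text \<open>
  The shape of the Chen-Teo metric: with \<open>\<theta> = d\<tau> + w d\<phi>\<close>, the coframe
  \<open>\<theta>, dy, dx, d\<phi>\<close> is orthogonal, with squared coefficients \<open>l, A, B, C\<close>.
\<close>

definition torus_metric :: "real \<Rightarrow> real \<Rightarrow> real \<Rightarrow> real \<Rightarrow> real \<Rightarrow> real^4^4" where
  "torus_metric l w A B C = l *\<^sub>R tensor_prod (d_\<tau> + w *\<^sub>R d_\<phi>) (d_\<tau> + w *\<^sub>R d_\<phi>)
     + A *\<^sub>R tensor_prod d_y d_y + B *\<^sub>R tensor_prod d_x d_x + C *\<^sub>R tensor_prod d_\<phi> d_\<phi>"

text \<open>
  The dual metric, in the dual frame \<open>\<partial>\<^sub>\<tau>, \<partial>\<^sub>y, \<partial>\<^sub>x, \<partial>\<^sub>\<phi> - w \<partial>\<^sub>\<tau>\<close> of the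
  orthogonal coframe.
\<close>

definition torus_cometric :: "real \<Rightarrow> real \<Rightarrow> real \<Rightarrow> real \<Rightarrow> real \<Rightarrow> real^4^4" where
  "torus_cometric l w A B C = (1 / l) *\<^sub>R tensor_prod partial_\<tau> partial_\<tau>
     + (1 / A) *\<^sub>R tensor_prod (axis 2 1) (axis 2 1) + (1 / B) *\<^sub>R tensor_prod (axis 3 1) (axis 3 1)
     + (1 / C) *\<^sub>R tensor_prod (partial_\<phi> - w *\<^sub>R partial_\<tau>) (partial_\<phi> - w *\<^sub>R partial_\<tau>)"

lemma det_torus_metric: "det (torus_metric l w A B C) = l * A * B * C"
  by (simp add: det_4 torus_metric_def tensor_prod_def axis_def algebra_simps)

lemma matrix_inv_eqI:
  fixes A B :: "real^'n^'n"
  assumes "A ** B = mat 1" "B ** A = mat 1"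
  shows "matrix_inv A = B"
proof -
  have "A ** matrix_inv A = mat 1 \<and> matrix_inv A ** A = mat 1"
    unfolding matrix_inv_def by (rule someI[of _ B]) (use assms in simp)
  then have "matrix_inv A = (B ** A) ** matrix_inv A" "B ** (A ** matrix_inv A) = B"
    using assms by simp_all
  then show ?thesis
    by (simp add: matrix_mul_assoc)
qed

lemma matrix_inv_torus_metric:
  assumes "l \<noteq> 0" "A \<noteq> 0" "B \<noteq> 0" "C \<noteq> 0"
  shows "matrix_inv (torus_metric l w A B C) = torus_cometric l w A B C"
proof (rule matrix_inv_eqI)
  show "torus_metric l w A B C ** torus_cometric l w A B C = mat 1"
    using assms
    by (simp add: torus_metric_def torus_cometric_def tensor_prod_def axis_def matrix_matrix_mult_def mat_def
        vec_eq_iff forall_4 sum_4 field_simps)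
  show "torus_cometric l w A B C ** torus_metric l w A B C = mat 1"
    using assms
    by (simp add: torus_metric_def torus_cometric_def tensor_prod_def axis_def matrix_matrix_mult_def mat_def
        vec_eq_iff forall_4 sum_4 field_simps)
qed

lemma hodge_star_torus_form:
  fixes l w A B C a b c d :: real
  assumes "l \<noteq> 0" "A \<noteq> 0" "B \<noteq> 0" "C \<noteq> 0"
  defines "V \<equiv> volume_form (torus_metric l w A B C)"
  shows "hodge_star (torus_metric l w A B C) (torus_form a b c d) =
    torus_form (V * (w * b + d) / (B * C)) (- V * (w * a + c) / (A * C))
      (- V * (b / l + w * (w * b + d) / C) / B) (V * (a / l + w * (w * a + c) / C) / A)"
proof -
  define h where "h = torus_cometric l w A B C"
  have h: "h $ 1 $ 1 = 1 / l + w\<^sup>2 / C" "h $ 1 $ 2 = 0" "h $ 1 $ 3 = 0" "h $ 1 $ 4 = - w / C"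
    "h $ 2 $ 1 = 0" "h $ 2 $ 2 = 1 / A" "h $ 2 $ 3 = 0" "h $ 2 $ 4 = 0"
    "h $ 3 $ 1 = 0" "h $ 3 $ 2 = 0" "h $ 3 $ 3 = 1 / B" "h $ 3 $ 4 = 0"
    "h $ 4 $ 1 = - w / C" "h $ 4 $ 2 = 0" "h $ 4 $ 3 = 0" "h $ 4 $ 4 = 1 / C"
    by (simp_all add: h_def torus_cometric_def tensor_prod_def axis_def power2_eq_square)
  have inv: "matrix_inv (torus_metric l w A B C) = h"
    unfolding h_def by (rule matrix_inv_torus_metric) (use assms in auto)
  show ?thesis
    unfolding hodge_star_def inv V_def[symmetric] vec_eq_iff forall_4
    by (simp add: sum_4 levi_civita_simps h torus_form_nth)
      (use assms(1-4) in \<open>simp add: field_simps power2_eq_square\<close>)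
qed

lemma torus_metric_mult_partial_\<tau>:
  "torus_metric l w A B C *v partial_\<tau> = l *\<^sub>R (d_\<tau> + w *\<^sub>R d_\<phi>)"
  by (simp add: torus_metric_def tensor_prod_def axis_def matrix_vector_mult_def vec_eq_iff forall_4 sum_4)

lemma wedge_eq_torus_form:
  "wedge_1_1 (l *\<^sub>R (d_\<tau> + w *\<^sub>R d_\<phi>)) (u *\<^sub>R d_y + v *\<^sub>R d_x)
    = torus_form (l * u) (l * v) (- l * w * u) (- l * w * v)"
  by (simp add: torus_form_def wedge_1_1_def tensor_prod_def axis_def vec_eq_iff forall_4)

text \<open>
  Since \<open>\<star>\<star> = 1\<close> on 2-forms, \<open>\<omega>\<close> is (anti-)self-dual, so
  \<open>\<omega> \<and> \<star>\<omega> = s \<omega> \<and> \<omega>\<close>. In this product the squares of \<open>\<beta>\<close> and of \<open>\<star>\<beta>\<close> vanish and only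
  \<open>2 \<beta> \<and> \<star>\<beta> / l\<^sup>2\<close> survives. The right-hand side is \<open>2 |d\<alpha>|\<^sup>2 / \<lambda>\<close> for \<open>d\<alpha> = u dy + v dx\<close>.
\<close>

lemma energy_density_torus_form:
  fixes l w A B C u v s :: real
  assumes pos: "l > 0" "A > 0" "B > 0" "C > 0" and s: "s = 1 \<or> s = - 1"
  defines "g \<equiv> torus_metric l w A B C"
  defines "\<beta> \<equiv> wedge_1_1 (l *\<^sub>R (d_\<tau> + w *\<^sub>R d_\<phi>)) (u *\<^sub>R d_y + v *\<^sub>R d_x)"
  defines "\<omega> \<equiv> (1 / l) *\<^sub>R (\<beta> + s *\<^sub>R hodge_star g \<beta>)"
  shows "wedge_2_2 \<omega> (hodge_star g \<omega>) / volume_form g = 2 * (u\<^sup>2 / A + v\<^sup>2 / B) / l"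
proof -
  define V where "V = volume_form g"
  have V: "V > 0" "V\<^sup>2 = l * A * B * C"
    using pos by (simp_all add: V_def volume_form_def g_def det_torus_metric)
  have nz: "l \<noteq> 0" "A \<noteq> 0" "B \<noteq> 0" "C \<noteq> 0" "V \<noteq> 0"
    using pos V by auto
  note star = hodge_star_torus_form[OF nz(1-4), of w, folded g_def, folded V_def]
  have "hodge_star g \<beta> = torus_form 0 0 (- V * v / B) (V * u / A)"
    unfolding \<beta>_def wedge_eq_torus_form star using nz by (simp add: field_simps)
  then have \<omega>: "\<omega> = torus_form u v (- w * u - s * V * v / (l * B)) (- w * v + s * V * u / (l * A))"
    unfolding \<omega>_def \<beta>_def wedge_eq_torus_form using nz
    by (simp add: torus_form_linear) (simp add: field_simps)
  \<comment> \<open>Eliminating \<open>C\<close> rather than \<open>V\<close> turns all the identities below into rational ones.\<close>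
  have C: "C = V * V / (l * A * B)"
    using V(2) nz by (simp add: field_simps power2_eq_square)
  have ss: "s * s = 1" "s * (s * r) = r" for r
    using s by auto
  define c d where "c = - w * u - s * V * v / (l * B)" and "d = - w * v + s * V * u / (l * A)"
  have cd: "w * u + c = - s * V * v / (l * B)" "w * v + d = s * V * u / (l * A)"
    by (simp_all add: c_def d_def)
  have "V * (w * v + d) / (B * C) = s * u" "- V * (w * u + c) / (A * C) = s * v"
    "- V * (v / l + w * (w * v + d) / C) / B = s * c" "V * (u / l + w * (w * u + c) / C) / A = s * d"
    unfolding cd unfolding c_def d_def C using nz by (simp_all add: field_simps ss)
  then have star_\<omega>: "hodge_star g \<omega> = s *\<^sub>R \<omega>"
    unfolding \<omega> c_def[symmetric] d_def[symmetric] star torus_form_linear by simp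
  have "wedge_2_2 \<omega> (hodge_star g \<omega>) = 2 * s * (u * d - v * c)"
    unfolding star_\<omega> unfolding \<omega> c_def[symmetric] d_def[symmetric] torus_form_linear wedge_torus_form
    by (simp add: algebra_simps)
  also have "\<dots> = 2 * V * (u\<^sup>2 / A + v\<^sup>2 / B) / l"
    unfolding c_def d_def using nz by (simp add: field_simps ss power2_eq_square)
  finally have "wedge_2_2 \<omega> (hodge_star g \<omega>) = 2 * V * (u\<^sup>2 / A + v\<^sup>2 / B) / l" .
  then show ?thesis
    using nz by (simp add: V_def)
qed

section \<open>Integrals and Borel sets in Euclidean space\<close>

text \<open>
  The antiderivatives \<open>2 sqrt (t - a)\<close> and \<open>-2 sqrt (b - t)\<close> are continuous up to the
  singular endpoint. There the integrands take the value \<open>0\<close>, as \<open>1 / 0 = 0\<close>.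
\<close>

lemma nn_integral_inverse_sqrt:
  fixes a b :: real
  assumes "a \<le> b"
  shows "(\<integral>\<^sup>+t. ennreal (indicator {a..b} t / sqrt (t - a)) \<partial>lborel) < \<infinity>"
    and "(\<integral>\<^sup>+t. ennreal (indicator {a..b} t / sqrt (b - t)) \<partial>lborel) < \<infinity>"
proof -
  have "((\<lambda>t. 1 / sqrt (t - a)) has_integral (2 * sqrt (b - a) - 2 * sqrt (a - a))) {a..b}"
    by (rule fundamental_theorem_of_calculus_interior[OF assms])
      (auto intro!: continuous_intros derivative_eq_intros
        simp: has_real_derivative_iff_has_vector_derivative[symmetric] field_simps)
  then have "((\<lambda>t. indicator {a..b} t / sqrt (t - a)) has_integral (2 * sqrt (b - a) - 2 * sqrt (a - a))) UNIV"
    by (subst (asm) has_integral_restrict_UNIV[symmetric])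
      (auto elim!: back_subst[of "\<lambda>f. (f has_integral _) UNIV"] simp: indicator_def fun_eq_iff)
  from nn_integral_has_integral_lborel[OF _ _ this]
  show "(\<integral>\<^sup>+t. ennreal (indicator {a..b} t / sqrt (t - a)) \<partial>lborel) < \<infinity>"
    by (auto simp: indicator_def)
  have "((\<lambda>t. 1 / sqrt (b - t)) has_integral (- 2 * sqrt (b - b) - (- 2 * sqrt (b - a)))) {a..b}"
    by (rule fundamental_theorem_of_calculus_interior[OF assms])
      (auto intro!: continuous_intros derivative_eq_intros
        simp: has_real_derivative_iff_has_vector_derivative[symmetric] field_simps)
  then have "((\<lambda>t. indicator {a..b} t / sqrt (b - t)) has_integral (- 2 * sqrt (b - b) - (- 2 * sqrt (b - a)))) UNIV"
    by (subst (asm) has_integral_restrict_UNIV[symmetric])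
      (auto elim!: back_subst[of "\<lambda>f. (f has_integral _) UNIV"] simp: indicator_def fun_eq_iff)
  from nn_integral_has_integral_lborel[OF _ _ this]
  show "(\<integral>\<^sup>+t. ennreal (indicator {a..b} t / sqrt (b - t)) \<partial>lborel) < \<infinity>"
    by (auto simp: indicator_def)
qed

text \<open>
  Tonelli's theorem for a product of functions of the single coordinates.
\<close>

lemma integrable_lborel_vec4_prod:
  fixes g :: "4 \<Rightarrow> real \<Rightarrow> real"
  assumes [measurable]: "\<And>i. g i \<in> borel_measurable borel" and nn: "\<And>i t. 0 \<le> g i t"
    and fin: "\<And>i. (\<integral>\<^sup>+t. ennreal (g i t) \<partial>lborel) < \<infinity>"
  shows "integrable lborel (\<lambda>p :: real^4. g 1 (p $ 1) * g 2 (p $ 2) * g 3 (p $ 3) * g 4 (p $ 4))"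
proof -
  \<comment> \<open>The product formula runs over basis vectors, so \<open>g\<close> has to be reindexed by them.\<close>
  define G where "G b t = ennreal (g (SOME i. b = axis i 1) t)" for b :: "real^4" and t
  have G: "G (axis i 1) t = ennreal (g i t)" for i t
  proof -
    have "(SOME j. axis i 1 = (axis j 1 :: real^4)) = i"
      by (rule some_equality) (auto simp: axis_eq_axis)
    then show ?thesis by (simp add: G_def)
  qed
  have Basis: "(Basis :: (real^4) set) = range (\<lambda>i. axis i 1)"
    by (auto simp: Basis_vec_def)
  have prod_Basis: "(\<Prod>b\<in>Basis. f b) = f (axis 1 1) * f (axis 2 1) * f (axis 3 1) * f (axis 4 1)"
    for f :: "real^4 \<Rightarrow> ennreal"
  proof -
    have "inj (\<lambda>i :: 4. axis i 1 :: real^4)"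
      by (auto simp: inj_on_def axis_eq_axis)
    from prod.reindex[OF this, of f] have "(\<Prod>b\<in>Basis. f b) = (\<Prod>i\<in>UNIV. f (axis i 1))"
      unfolding Basis by (simp only: comp_def)
    also have "\<dots> = f (axis 1 1) * f (axis 2 1) * f (axis 3 1) * f (axis 4 1)"
      unfolding UNIV_4 by (simp add: ac_simps)
    finally show ?thesis .
  qed
  have "(\<integral>\<^sup>+p. ennreal (g 1 (p $ 1) * g 2 (p $ 2) * g 3 (p $ 3) * g 4 (p $ 4))
        \<partial>(lborel :: (real^4) measure))
      = (\<integral>\<^sup>+p. (\<Prod>b\<in>Basis. G b (p \<bullet> b)) \<partial>(lborel :: (real^4) measure))"
    unfolding prod_Basis G inner_axis
    by (intro nn_integral_cong) (simp add: ennreal_mult nn flip: mult.assoc)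
  also have "\<dots> = (\<Prod>b\<in>Basis. \<integral>\<^sup>+t. G b t \<partial>lborel)"
    by (rule nn_integral_lborel_prod) (simp_all add: G_def)
  also have "\<dots> < \<infinity>"
    unfolding prod_Basis G using fin by (auto simp: ennreal_mult_less_top)
  finally have "(\<integral>\<^sup>+p. ennreal (g 1 (p $ 1) * g 2 (p $ 2) * g 3 (p $ 3) * g 4 (p $ 4)) \<partial>(lborel :: (real^4) measure)) < \<infinity>" .
  moreover have "norm (g 1 (p $ 1) * g 2 (p $ 2) * g 3 (p $ 3) * g 4 (p $ 4))
      = g 1 (p $ 1) * g 2 (p $ 2) * g 3 (p $ 3) * g 4 (p $ 4)" for p :: "real^4"
    by (simp add: nn)
  moreover have "(\<lambda>p :: real^4. p $ i) \<in> borel_measurable borel" for i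
    by (intro borel_measurable_continuous_onI continuous_intros)
  ultimately show ?thesis
    unfolding integrable_iff_bounded by (simp del: real_norm_def)
qed

text \<open>
  An open set is a countable union of compact boxes, so the intersection with a closed set
  is \<open>\<sigma>\<close>-compact and so is its image. Images of Borel sets in general need not be Borel.
\<close>

lemma borel_linear_image_open_Int_closed:
  fixes f :: "'a::euclidean_space \<Rightarrow> 'b::euclidean_space"
  assumes "linear f" "open U" "closed Z"
  shows "f ` (U \<inter> Z) \<in> sets borel"
proof -
  obtain D where D: "countable D" "D \<subseteq> Pow U" "\<And>X. X \<in> D \<Longrightarrow> \<exists>a b. X = cbox a b" "\<Union>D = U"
    using open_countable_Union_open_cbox[OF assms(2)] by metis
  have "f ` (U \<inter> Z) = (\<Union>X\<in>D. f ` (X \<inter> Z))"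
    using D(4) by blast
  moreover have "f ` (X \<inter> Z) \<in> sets borel" if "X \<in> D" for X
    using D(3)[OF that] assms
    by (auto intro!: borel_closed compact_imp_closed compact_continuous_image linear_continuous_on
        compact_Int_closed simp: linear_conv_bounded_linear)
  ultimately show ?thesis
    using D(1) by (auto intro!: sets.countable_UN')
qed

lemma inverse_sum_le_inverse_sqrt:
  fixes s t :: real
  assumes "s > 0" "t > 0"
  shows "1 / (s + t) \<le> 1 / sqrt s * (1 / sqrt t)"
proof -
  have "sqrt s * sqrt t \<le> (s + t) / 2"
    using arith_geo_mean_sqrt[of s t] assms by (simp add: real_sqrt_mult)
  also have "\<dots> \<le> s + t" using assms by simp
  finally show ?thesis using assms by (simp add: frac_le)
qed

section \<open>Coordinate expressions on the chart\<close>

lemma differential_eqI: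
  assumes "(\<alpha> has_derivative (\<lambda>h. a * h $ 2 + b * h $ 3)) (at p)"
  shows "differential \<alpha> p = a *\<^sub>R d_y + b *\<^sub>R d_x"
  unfolding differential_def frechet_derivative_at[OF assms, symmetric]
  by (simp add: vec_eq_iff forall_4 axis_def)

text \<open>
  The entries of a point are listed in the order \<open>(\<tau>, y, x, \<phi>)\<close>, the pair in the
  order \<open>(x, y)\<close>.
\<close>

definition xy :: "real^4 \<Rightarrow> real \<times> real" where
  "xy p = (ct_x p, ct_y p)"

lemma continuous_on_xy: "continuous_on S xy"
  unfolding xy_def by (intro continuous_intros)

section \<open>Signs of the Chen-Teo functions\<close>

locale chen_teo =
  fixes \<kappa> \<xi> :: real
  assumes kappa_pos: "\<kappa> > 0" and xi_lower: "1 / 2 < \<xi>" and xi_upper: "\<xi> < 1 / sqrt 2"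
begin

abbreviation "\<nu> \<equiv> ct_nu \<xi>"
abbreviation "x\<^sub>1 \<equiv> ct_x1 \<xi>"
abbreviation "x\<^sub>2 \<equiv> ct_x2 \<xi>"
abbreviation "x\<^sub>3 \<equiv> ct_x3 \<xi>"

text \<open>
  The factor of \<open>H\<close> besides \<open>\<nu> x + y\<close>, with \<open>a\<^sub>3 = 1\<close> inserted.
\<close>

definition Q :: "real \<Rightarrow> real \<Rightarrow> real" where
  "Q x y = (\<nu> * x - y) * (ct_a \<xi> 1 - x * y) - 2 * (1 - \<nu>) * ct_a \<xi> 0"

lemma two_xi_squared: "2 * \<xi>\<^sup>2 < 1"
proof -
  have "\<xi>\<^sup>2 < (1 / sqrt 2)\<^sup>2"
    using xi_lower xi_upper by (intro power_strict_mono) auto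
  then show ?thesis by (simp add: power_divide)
qed

lemma nu_bounds: "- 1 < \<nu>" "\<nu> < 0"
  using two_xi_squared xi_lower by (auto simp: ct_nu_def)

lemma roots_ordered: "x\<^sub>1 < x\<^sub>2" "x\<^sub>2 < x\<^sub>3" "x\<^sub>3 < 0"
proof -
  have "x\<^sub>2 - x\<^sub>1 = \<xi> * (2 * \<xi> - 1) * (1 - 2 * \<xi>\<^sup>2)"
    unfolding ct_x1_def ct_x2_def by algebra
  also have "\<dots> > 0" using two_xi_squared xi_lower by (intro mult_pos_pos) auto
  finally show "x\<^sub>1 < x\<^sub>2" by simp
  have "2 * \<xi>\<^sup>2 \<ge> 2 * \<xi> * (1/2)" using xi_lower by (simp add: power2_eq_square)
  then have "\<xi> < 1" using two_xi_squared by linarith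
  have "x\<^sub>3 - x\<^sub>2 = (1 - \<xi>) * (1 - 2 * \<xi>\<^sup>2)"
    unfolding ct_x3_def ct_x2_def by algebra
  also have "\<dots> > 0" using two_xi_squared \<open>\<xi> < 1\<close> by (intro mult_pos_pos) auto
  finally show "x\<^sub>2 < x\<^sub>3" by simp
  show "x\<^sub>3 < 0" using xi_lower by (simp add: ct_x3_def)
qed

lemma poly_P: "poly (ct_P \<xi>) u = (u - x\<^sub>1) * (u - x\<^sub>2) * (u - x\<^sub>3)"
  by (simp add: ct_P_def algebra_simps)

lemma coeff_P:
  "ct_a \<xi> 0 = - x\<^sub>1 * x\<^sub>2 * x\<^sub>3" "ct_a \<xi> 1 = x\<^sub>1 * x\<^sub>2 + x\<^sub>1 * x\<^sub>3 + x\<^sub>2 * x\<^sub>3"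
  "ct_a \<xi> (Suc 0) = x\<^sub>1 * x\<^sub>2 + x\<^sub>1 * x\<^sub>3 + x\<^sub>2 * x\<^sub>3" "ct_a \<xi> 3 = 1"
  by (simp_all add: ct_a_def ct_P_def algebra_simps eval_nat_numeral)

text \<open>
  At a corner \<open>(x\<^sub>i, x\<^sub>j)\<close> the terms of \<open>Q\<close> combine to a product of factors whose signs are given
  by the order of the roots and by \<open>-1 < \<nu> < 0\<close>. This includes the corner \<open>(x\<^sub>2, x\<^sub>2)\<close> at infinity,
  which is what keeps \<open>1 / Q\<close> bounded near infinity.
\<close>

lemma Q_pos_corners:
  "Q x\<^sub>2 x\<^sub>2 > 0" "Q x\<^sub>2 x\<^sub>1 > 0" "Q x\<^sub>3 x\<^sub>2 > 0" "Q x\<^sub>3 x\<^sub>1 > 0"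
proof -
  note r = roots_ordered nu_bounds
  have nu: "- \<nu> * a > b" if "a < 0" "b < a" for a b
  proof -
    have "(- \<nu>) * a \<ge> 1 * a" using that r by (intro mult_right_mono_neg) auto
    then show ?thesis using that by linarith
  qed
  have "Q x\<^sub>2 x\<^sub>2 = (1 - \<nu>) * ((- x\<^sub>2) * (x\<^sub>2 - x\<^sub>1) * (x\<^sub>3 - x\<^sub>2))"
    unfolding Q_def coeff_P by algebra
  also have "\<dots> > 0" using r by (intro mult_pos_pos) auto
  finally show "Q x\<^sub>2 x\<^sub>2 > 0" .
  have "Q x\<^sub>2 x\<^sub>1 = (- x\<^sub>3) * (x\<^sub>2 - x\<^sub>1) * (- \<nu> * x\<^sub>2 - x\<^sub>1)"
    unfolding Q_def coeff_P by algebra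
  also have "\<dots> > 0" using r nu[of x\<^sub>2 x\<^sub>1] by (intro mult_pos_pos) auto
  finally show "Q x\<^sub>2 x\<^sub>1 > 0" .
  have "Q x\<^sub>3 x\<^sub>2 = (- x\<^sub>1) * (x\<^sub>3 - x\<^sub>2) * (- \<nu> * x\<^sub>3 - x\<^sub>2)"
    unfolding Q_def coeff_P by algebra
  also have "\<dots> > 0" using r nu[of x\<^sub>3 x\<^sub>2] by (intro mult_pos_pos) auto
  finally show "Q x\<^sub>3 x\<^sub>2 > 0" .
  have "Q x\<^sub>3 x\<^sub>1 = (- x\<^sub>2) * (x\<^sub>3 - x\<^sub>1) * (- \<nu> * x\<^sub>3 - x\<^sub>1)"
    unfolding Q_def coeff_P by algebra
  also have "\<dots> > 0" using r nu[of x\<^sub>3 x\<^sub>1] by (intro mult_pos_pos) auto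
  finally show "Q x\<^sub>3 x\<^sub>1 > 0" .
qed

text \<open>
  A concave function that is positive at the endpoints is positive in between; the last
  hypothesis is concavity at the one point \<open>t\<close>.
\<close>

lemma interpolation_pos:
  fixes a b r s t q :: real
  assumes "a \<le> t" "t \<le> b" "a < b" "r > 0" "s > 0"
    and "q * (b - a) \<ge> (b - t) * r + (t - a) * s"
  shows "q > 0"
proof -
  have "(b - t) * r + (t - a) * s > 0"
  proof (cases "t = a")
    case False
    then show ?thesis using assms by (intro add_nonneg_pos) auto
  qed (use assms in auto)
  then have "q * (b - a) > 0" using assms by linarith
  then show ?thesis using assms by (simp add: zero_less_mult_iff)
qed

text \<open>
  \<open>Q\<close> is quadratic in each variable, with leading coefficient \<open>- \<nu> y < 0\<close> in \<open>x\<close> and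
  \<open>x < 0\<close> in \<open>y\<close>. Being concave in each variable, it is bounded below by interpolation between the
  corners, first along the two edges \<open>x = x\<^sub>2\<close> and \<open>x = x\<^sub>3\<close> and then across.
\<close>

lemma Q_pos:
  assumes x: "x\<^sub>2 \<le> x" "x \<le> x\<^sub>3" and y: "x\<^sub>1 \<le> y" "y \<le> x\<^sub>2"
  shows "Q x y > 0"
proof -
  note r = roots_ordered nu_bounds
  have edge: "Q a y > 0" if "Q a x\<^sub>1 > 0" "Q a x\<^sub>2 > 0" "a < 0" for a
  proof (rule interpolation_pos[OF y r(1) that(1,2)])
    \<comment> \<open>A quadratic exceeds its linear interpolation by minus its leading coefficient, here \<open>a\<close>,
      times the product of the distances to the two nodes.\<close>
    have "Q a y * (x\<^sub>2 - x\<^sub>1) = (x\<^sub>2 - y) * Q a x\<^sub>1 + (y - x\<^sub>1) * Q a x\<^sub>2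
        + (- a) * (y - x\<^sub>1) * (x\<^sub>2 - y) * (x\<^sub>2 - x\<^sub>1)"
      unfolding Q_def by algebra
    moreover have "(- a) * (y - x\<^sub>1) * (x\<^sub>2 - y) * (x\<^sub>2 - x\<^sub>1) \<ge> 0"
      using that y r by (intro mult_nonneg_nonneg) auto
    ultimately show "Q a y * (x\<^sub>2 - x\<^sub>1) \<ge> (x\<^sub>2 - y) * Q a x\<^sub>1 + (y - x\<^sub>1) * Q a x\<^sub>2"
      by linarith
  qed
  show ?thesis
  proof (rule interpolation_pos[OF x r(2) edge edge])
    have "Q x y * (x\<^sub>3 - x\<^sub>2) = (x\<^sub>3 - x) * Q x\<^sub>2 y + (x - x\<^sub>2) * Q x\<^sub>3 y
        + (- \<nu>) * (- y) * (x - x\<^sub>2) * (x\<^sub>3 - x) * (x\<^sub>3 - x\<^sub>2)"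
      unfolding Q_def by algebra
    moreover have "(- \<nu>) * (- y) * (x - x\<^sub>2) * (x\<^sub>3 - x) * (x\<^sub>3 - x\<^sub>2) \<ge> 0"
      using x y r by (intro mult_nonneg_nonneg) auto
    ultimately show "Q x y * (x\<^sub>3 - x\<^sub>2) \<ge> (x\<^sub>3 - x) * Q x\<^sub>2 y + (x - x\<^sub>2) * Q x\<^sub>3 y"
      by linarith
  qed (use Q_pos_corners r in auto)
qed

text \<open>
  \<open>\<nu> x + y \<le> (1 + \<nu>) x\<^sub>2 < 0\<close>, as \<open>\<nu> < 0\<close>, \<open>x \<ge> x\<^sub>2\<close> and \<open>y \<le> x\<^sub>2\<close>.
\<close>

lemma nu_x_plus_y_neg:
  assumes "x\<^sub>2 \<le> x" "x \<le> x\<^sub>3" "x\<^sub>1 \<le> y" "y \<le> x\<^sub>2"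
  shows "\<nu> * x + y < 0"
proof -
  have "(- \<nu>) * x \<ge> (- \<nu>) * x\<^sub>2" "(1 + \<nu>) * x\<^sub>2 < 0"
    using assms nu_bounds roots_ordered by (auto simp: mult_pos_neg)
  then show ?thesis using assms by (simp add: algebra_simps)
qed

lemma P_neg: "x\<^sub>2 < x \<Longrightarrow> x < x\<^sub>3 \<Longrightarrow> poly (ct_P \<xi>) x < 0"
  unfolding poly_P using roots_ordered by (intro mult_pos_neg mult_pos_pos) auto

lemma P_pos: "x\<^sub>1 < y \<Longrightarrow> y < x\<^sub>2 \<Longrightarrow> poly (ct_P \<xi>) y > 0"
  unfolding poly_P using roots_ordered by (intro mult_neg_neg mult_pos_neg) auto

lemma ct_H_eq: "ct_H \<xi> p = (\<nu> * ct_x p + ct_y p) * Q (ct_x p) (ct_y p)"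
  by (simp add: ct_H_def Q_def coeff_P)

lemma chart_signs:
  assumes "p \<in> ct_chart \<xi>"
  shows "ct_x p - ct_y p > 0" "ct_X \<xi> p < 0" "ct_Y \<xi> p > 0" "ct_F \<xi> p < 0" "ct_H \<xi> p < 0"
proof -
  have p: "x\<^sub>1 < ct_y p" "ct_y p < x\<^sub>2" "x\<^sub>2 < ct_x p" "ct_x p < x\<^sub>3"
    using assms by (auto simp: ct_chart_def)
  show "ct_x p - ct_y p > 0" using p by linarith
  show X: "ct_X \<xi> p < 0" and Y: "ct_Y \<xi> p > 0"
    using P_neg P_pos p by (auto simp: ct_X_def ct_Y_def)
  have "(ct_y p)\<^sup>2 * ct_X \<xi> p < 0" "(ct_x p)\<^sup>2 * ct_Y \<xi> p > 0"
    using X Y p roots_ordered by (auto simp: mult_pos_neg)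
  then show "ct_F \<xi> p < 0" by (simp add: ct_F_def)
  show "ct_H \<xi> p < 0"
    unfolding ct_H_eq using p by (intro mult_neg_pos nu_x_plus_y_neg Q_pos) auto
qed

section \<open>Metric, volume and energy density on the chart\<close>

lemma ct_metric_eq_torus_metric:
  assumes "p \<in> ct_chart \<xi>"
  defines "d \<equiv> ct_x p - ct_y p"
  shows "ct_metric \<kappa> \<xi> p = torus_metric (ct_F \<xi> p / (d * ct_H \<xi> p)) (ct_G \<xi> p / ct_F \<xi> p)
    (- \<kappa> * ct_H \<xi> p / (d ^ 3 * ct_Y \<xi> p)) (\<kappa> * ct_H \<xi> p / (d ^ 3 * ct_X \<xi> p))
    (- ct_H \<xi> p * ct_X \<xi> p * ct_Y \<xi> p / (d ^ 3 * ct_F \<xi> p))"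
  using chart_signs[OF assms(1)] kappa_pos
  by (simp add: ct_metric_def torus_metric_def d_def[symmetric] vec_eq_iff forall_4 tensor_prod_def axis_def mult_ac)

lemma metric_coefficients_pos:
  assumes "p \<in> ct_chart \<xi>"
  defines "d \<equiv> ct_x p - ct_y p"
  shows "ct_F \<xi> p / (d * ct_H \<xi> p) > 0" "- \<kappa> * ct_H \<xi> p / (d ^ 3 * ct_Y \<xi> p) > 0"
    "\<kappa> * ct_H \<xi> p / (d ^ 3 * ct_X \<xi> p) > 0"
    "- ct_H \<xi> p * ct_X \<xi> p * ct_Y \<xi> p / (d ^ 3 * ct_F \<xi> p) > 0"
  using chart_signs[OF assms(1), folded d_def] kappa_pos
  by (auto simp: zero_less_divide_iff divide_less_0_iff zero_less_mult_iff mult_less_0_iff)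

text \<open>
  In the product of the four coefficients of the metric the factors \<open>F\<close>, \<open>X\<close> and \<open>Y\<close> cancel.
\<close>

lemma volume_form_ct_metric:
  assumes "p \<in> ct_chart \<xi>"
  shows "volume_form (ct_metric \<kappa> \<xi> p) = \<kappa> * (- ct_H \<xi> p) / (ct_x p - ct_y p) ^ 5"
proof -
  define d where "d = ct_x p - ct_y p"
  note sgn = chart_signs[OF assms, folded d_def]
  have "volume_form (ct_metric \<kappa> \<xi> p) = sqrt ((\<kappa> * (- ct_H \<xi> p) / d ^ 5)\<^sup>2)"
    unfolding volume_form_def ct_metric_eq_torus_metric[OF assms] det_torus_metric d_def[symmetric]
    using sgn kappa_pos by (intro arg_cong[where f = sqrt]) (simp add: field_simps eval_nat_numeral)
  also have "\<dots> = \<kappa> * (- ct_H \<xi> p) / d ^ 5"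
    using sgn kappa_pos by (simp only: real_sqrt_abs) (intro abs_of_pos divide_pos_pos mult_pos_pos; simp)
  finally show ?thesis by (simp add: d_def)
qed

lemma energy_density_ct_form:
  assumes p: "p \<in> ct_chart \<xi>"
    and \<alpha>: "differential \<alpha> p = u *\<^sub>R d_y + v *\<^sub>R d_x"
    and \<omega>: "\<omega> = ct_sd_form \<kappa> \<xi> \<alpha> \<or> \<omega> = ct_asd_form \<kappa> \<xi> \<alpha>"
  shows "wedge_2_2 (\<omega> p) (hodge_star (ct_metric \<kappa> \<xi> p) (\<omega> p)) / volume_form (ct_metric \<kappa> \<xi> p)
    = 2 * (ct_x p - ct_y p) ^ 4 * (ct_X \<xi> p * v\<^sup>2 - ct_Y \<xi> p * u\<^sup>2) / (\<kappa> * ct_F \<xi> p)"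
proof -
  define d where "d = ct_x p - ct_y p"
  define l w A B C where "l = ct_F \<xi> p / (d * ct_H \<xi> p)" and "w = ct_G \<xi> p / ct_F \<xi> p"
    and "A = - \<kappa> * ct_H \<xi> p / (d ^ 3 * ct_Y \<xi> p)" and "B = \<kappa> * ct_H \<xi> p / (d ^ 3 * ct_X \<xi> p)"
    and "C = - ct_H \<xi> p * ct_X \<xi> p * ct_Y \<xi> p / (d ^ 3 * ct_F \<xi> p)"
  note lABC = l_def w_def A_def B_def C_def
  note g = ct_metric_eq_torus_metric[OF p, folded d_def, folded lABC]
  note pos = metric_coefficients_pos[OF p, folded d_def, folded lABC]
  have K: "ct_K_flat \<kappa> \<xi> p = l *\<^sub>R (d_\<tau> + w *\<^sub>R d_\<phi>)"
    by (simp add: ct_K_flat_def ct_K_def g torus_metric_mult_partial_\<tau>)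
  have lam: "ct_lambda \<kappa> \<xi> p = l"
    unfolding ct_lambda_def ct_K_def g torus_metric_mult_partial_\<tau>
    by (simp add: inner_vec_def sum_4 axis_def)
  obtain s :: real where s: "s = 1 \<or> s = - 1" and "\<omega> p = (1 / l) *\<^sub>R
    (wedge_1_1 (l *\<^sub>R (d_\<tau> + w *\<^sub>R d_\<phi>)) (u *\<^sub>R d_y + v *\<^sub>R d_x)
     + s *\<^sub>R hodge_star (torus_metric l w A B C)
         (wedge_1_1 (l *\<^sub>R (d_\<tau> + w *\<^sub>R d_\<phi>)) (u *\<^sub>R d_y + v *\<^sub>R d_x)))"
    using \<omega>
  proof
    assume "\<omega> = ct_sd_form \<kappa> \<xi> \<alpha>"
    then show ?thesis
      by (intro that[of 1]) (simp_all add: ct_sd_form_def K lam \<alpha> g Let_def)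
  next
    assume "\<omega> = ct_asd_form \<kappa> \<xi> \<alpha>"
    then show ?thesis
      by (intro that[of "-1"]) (simp_all add: ct_asd_form_def K lam \<alpha> g Let_def)
  qed
  then have "wedge_2_2 (\<omega> p) (hodge_star (ct_metric \<kappa> \<xi> p) (\<omega> p)) / volume_form (ct_metric \<kappa> \<xi> p)
      = 2 * (u\<^sup>2 / A + v\<^sup>2 / B) / l"
    unfolding g by (simp only: energy_density_torus_form[OF pos s])
  also have "\<dots> = 2 * d ^ 4 * (ct_X \<xi> p * v\<^sup>2 - ct_Y \<xi> p * u\<^sup>2) / (\<kappa> * ct_F \<xi> p)"
    unfolding lABC using chart_signs[OF p, folded d_def] kappa_pos
    by (simp add: field_simps eval_nat_numeral)
  finally show ?thesis by (simp add: d_def)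
qed

section \<open>The coordinate rectangle\<close>

definition rect :: "(real \<times> real) set" where
  "rect = {x\<^sub>2..x\<^sub>3} \<times> {x\<^sub>1..x\<^sub>2}"

definition open_rect :: "(real \<times> real) set" where
  "open_rect = {x\<^sub>2<..<x\<^sub>3} \<times> {x\<^sub>1<..<x\<^sub>2}"

lemma open_rect_subset: "open_rect \<subseteq> rect"
  by (auto simp: open_rect_def rect_def)

lemma open_open_rect: "open open_rect"
  by (simp add: open_rect_def open_Times)

lemma compact_rect: "compact rect"
  by (simp add: rect_def compact_Times)

lemma chart_iff: "p \<in> ct_chart \<xi> \<longleftrightarrow> xy p \<in> open_rect"
  by (auto simp: ct_chart_def open_rect_def xy_def)

lemma chart_eq: "ct_chart \<xi> = xy -` open_rect"
  using chart_iff by blast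

lemma open_chart: "open (ct_chart \<xi>)"
  using open_vimage[OF open_open_rect continuous_on_xy] by (simp add: chart_eq)

lemma chart_subset_region: "ct_chart \<xi> \<subseteq> ct_region \<xi>"
  by (auto simp: ct_chart_def ct_region_def)

section \<open>Invariant functions on the quotient\<close>

text \<open>
  Lattice vectors and vanishing generators have no \<open>x\<close> or \<open>y\<close> component, so identified points
  lie over the same point of the rectangle.
\<close>

lemma xy_eq_if_rel:
  assumes "(p, q) \<in> ct_rel \<kappa> \<xi>"
  shows "xy q = xy p"
proof -
  have l: "ct_l1 \<kappa> \<xi> $ i = 0" "ct_l2 \<kappa> \<xi> $ i = 0" if "i = 2 \<or> i = 3" for i
    using that by (auto simp: ct_l1_def ct_l2_def axis_def)
  have "span (ct_vanishing \<kappa> \<xi> p) \<subseteq> {v. v $ 2 = 0 \<and> v $ 3 = 0}"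
    by (rule span_minimal) (auto simp: ct_vanishing_def ct_l3_def l intro!: subspaceI)
  moreover obtain m n :: int where "q - p - (2 * pi * of_int m) *\<^sub>R ct_l1 \<kappa> \<xi>
      - (2 * pi * of_int n) *\<^sub>R ct_l2 \<kappa> \<xi> \<in> span (ct_vanishing \<kappa> \<xi> p)"
    using assms by (auto simp: ct_rel_def)
  ultimately show ?thesis
    by (auto simp: xy_def l)
qed

lemma mem_ct_proj: "p \<in> ct_region \<xi> \<Longrightarrow> p \<in> ct_proj \<kappa> \<xi> p"
  unfolding ct_proj_def ct_rel_def by (auto intro!: exI[of _ 0] span_zero)

lemma xy_on_ct_proj: "q \<in> ct_proj \<kappa> \<xi> p \<Longrightarrow> xy q = xy p"
  unfolding ct_proj_def using xy_eq_if_rel by blast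

lemma ct_M_cases:
  assumes "m \<in> ct_M \<kappa> \<xi>"
  obtains p where "p \<in> ct_region \<xi>" "m = ct_proj \<kappa> \<xi> p"
  using assms unfolding ct_M_def ct_proj_def quotient_def by blast

lemma ct_proj_in_M: "p \<in> ct_region \<xi> \<Longrightarrow> ct_proj \<kappa> \<xi> p \<in> ct_M \<kappa> \<xi>"
  unfolding ct_M_def ct_proj_def by (rule quotientI)

text \<open>
  The map induced by \<open>(x, y)\<close> on \<open>M\<close>; the choice of representative does not matter
  (\<open>xy_M_ct_proj\<close>).
\<close>

definition xy_M :: "(real^4) set \<Rightarrow> real \<times> real" where
  "xy_M m = xy (SOME p. p \<in> m)"

lemma xy_M_ct_proj:
  assumes "p \<in> ct_region \<xi>"
  shows "xy_M (ct_proj \<kappa> \<xi> p) = xy p"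
  unfolding xy_M_def using mem_ct_proj[OF assms] by (intro xy_on_ct_proj someI)

lemma space_sigma_M: "space (sigma (ct_M \<kappa> \<xi>) (ct_open_sets \<kappa> \<xi>)) = ct_M \<kappa> \<xi>"
  by (rule space_measure_of) (auto simp: ct_open_sets_def)

lemma open_set_measurable:
  assumes "U \<in> ct_open_sets \<kappa> \<xi>"
  shows "U \<in> sets (sigma (ct_M \<kappa> \<xi>) (ct_open_sets \<kappa> \<xi>))"
  by (rule in_measure_of) (use assms in \<open>auto simp: ct_open_sets_def\<close>)

text \<open>
  The map is continuous for the quotient topology, so preimages of open sets are generators
  of the \<open>\<sigma>\<close>-algebra.
\<close>

lemma measurable_xy_M:
  "xy_M \<in> borel_measurable (sigma (ct_M \<kappa> \<xi>) (ct_open_sets \<kappa> \<xi>))"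
proof (rule borel_measurableI)
  fix S :: "(real \<times> real) set" assume S: "open S"
  have "{p \<in> ct_region \<xi>. ct_proj \<kappa> \<xi> p \<in> xy_M -` S \<inter> ct_M \<kappa> \<xi>} = ct_region \<xi> \<inter> xy -` S"
    using xy_M_ct_proj ct_proj_in_M by auto
  moreover have "open (xy -` S)"
    using S continuous_on_xy by (rule open_vimage)
  ultimately have "xy_M -` S \<inter> ct_M \<kappa> \<xi> \<in> ct_open_sets \<kappa> \<xi>"
    unfolding ct_open_sets_def by (auto simp: openin_open_Int)
  then show "xy_M -` S \<inter> space (sigma (ct_M \<kappa> \<xi>) (ct_open_sets \<kappa> \<xi>))
      \<in> sets (sigma (ct_M \<kappa> \<xi>) (ct_open_sets \<kappa> \<xi>))"
    unfolding space_sigma_M by (rule open_set_measurable)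
qed

lemma measurable_ct_proj:
  assumes A: "A \<subseteq> ct_region \<xi>"
  shows "ct_proj \<kappa> \<xi> \<in> restrict_space lborel A \<rightarrow>\<^sub>M sigma (ct_M \<kappa> \<xi>) (ct_open_sets \<kappa> \<xi>)"
proof (rule measurable_measure_of)
  show "ct_open_sets \<kappa> \<xi> \<subseteq> Pow (ct_M \<kappa> \<xi>)"
    by (auto simp: ct_open_sets_def)
  show "ct_proj \<kappa> \<xi> \<in> space (restrict_space lborel A) \<rightarrow> ct_M \<kappa> \<xi>"
    using A ct_proj_in_M by (auto simp: space_restrict_space)
  fix U assume "U \<in> ct_open_sets \<kappa> \<xi>"
  then obtain T where T: "open T" "{p \<in> ct_region \<xi>. ct_proj \<kappa> \<xi> p \<in> U} = ct_region \<xi> \<inter> T"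
    by (auto simp: ct_open_sets_def openin_open)
  then have "ct_proj \<kappa> \<xi> -` U \<inter> A = A \<inter> T"
    using A by blast
  then show "ct_proj \<kappa> \<xi> -` U \<inter> space (restrict_space lborel A) \<in> sets (restrict_space lborel A)"
    using T(1) by (auto simp: space_restrict_space sets_restrict_space)
qed

text \<open>
  A point of \<open>M\<close> comes from the chart exactly when it lies over the open rectangle.
\<close>

lemma ct_descend_eq:
  assumes f: "\<And>p. p \<in> ct_chart \<xi> \<Longrightarrow> f p = h (xy p)" and m: "m \<in> ct_M \<kappa> \<xi>"
  shows "ct_descend \<xi> f m = indicator open_rect (xy_M m) *\<^sub>R h (xy_M m)"
proof -
  obtain p where p: "p \<in> ct_region \<xi>" and m: "m = ct_proj \<kappa> \<xi> p"
    using m by (rule ct_M_cases)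
  have xy_M: "xy_M m = xy p"
    unfolding m by (rule xy_M_ct_proj[OF p])
  show ?thesis
  proof (cases "p \<in> ct_chart \<xi>")
    case True
    then have ex: "\<exists>q. q \<in> m \<inter> ct_chart \<xi>"
      using mem_ct_proj[OF p] m by blast
    from someI_ex[OF this] have "f (SOME q. q \<in> m \<inter> ct_chart \<xi>) = h (xy p)"
      using f xy_on_ct_proj m by auto
    then show ?thesis
      using True ex by (auto simp: ct_descend_def xy_M chart_iff)
  next
    case False
    then have "m \<inter> ct_chart \<xi> = {}"
      using xy_on_ct_proj m by (auto simp: chart_iff)
    then show ?thesis
      using False by (simp add: ct_descend_def xy_M chart_iff)
  qed
qed

text \<open>
  By the previous lemma the descended function factors through \<open>xy_M\<close>.
\<close>

lemma measurable_ct_descend: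
  assumes f: "\<And>p. p \<in> ct_chart \<xi> \<Longrightarrow> f p = h (xy p)" and h: "continuous_on open_rect h"
  shows "ct_descend \<xi> f \<in> borel_measurable (sigma (ct_M \<kappa> \<xi>) (ct_open_sets \<kappa> \<xi>))"
proof -
  have "(\<lambda>z. indicator open_rect z *\<^sub>R h z) \<in> borel_measurable borel"
    by (intro borel_measurable_continuous_on_indicator h borel_open open_open_rect)
  from measurable_compose[OF measurable_xy_M this] show ?thesis
    by (subst measurable_cong) (auto simp: space_sigma_M ct_descend_eq[of f h, OF f])
qed

section \<open>The period cell\<close>

text \<open>
  The period cell is the linear image of a half-open box, which is the intersection of an
  open and a closed set.
\<close>

lemma fundamental_domain_borel: "ct_fundamental_domain \<kappa> \<xi> \<in> sets borel"
proof -
  define L :: "real^4 \<Rightarrow> real^4" where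
    "L q = q $ 1 *\<^sub>R ct_l1 \<kappa> \<xi> + q $ 4 *\<^sub>R ct_l2 \<kappa> \<xi> + q $ 2 *\<^sub>R axis 2 1 + q $ 3 *\<^sub>R axis 3 1" for q
  define U where "U = ct_chart \<xi> \<inter> {q. q $ 1 < 2 * pi} \<inter> {q. q $ 4 < 2 * pi}"
  define Z :: "(real^4) set" where "Z = {q. 0 \<le> q $ 1} \<inter> {q. 0 \<le> q $ 4}"
  have L: "L q $ 2 = q $ 2" "L q $ 3 = q $ 3" for q
    by (simp_all add: L_def ct_l1_def ct_l2_def axis_def)
  have "ct_fundamental_domain \<kappa> \<xi> = L ` (U \<inter> Z)"
  proof (intro equalityI subsetI)
    fix p assume "p \<in> ct_fundamental_domain \<kappa> \<xi>"
    then obtain s t where p: "p \<in> ct_chart \<xi>" and st: "0 \<le> s" "s < 2 * pi" "0 \<le> t" "t < 2 * pi"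
      and eq: "p = s *\<^sub>R ct_l1 \<kappa> \<xi> + t *\<^sub>R ct_l2 \<kappa> \<xi> + ct_y p *\<^sub>R axis 2 1 + ct_x p *\<^sub>R axis 3 1"
      unfolding ct_fundamental_domain_def by blast
    define q :: "real^4" where "q = (\<chi> i. if i = 1 then s else if i = 4 then t else p $ i)"
    have q: "q $ 1 = s" "q $ 4 = t" "q $ 2 = p $ 2" "q $ 3 = p $ 3"
      by (simp_all add: q_def)
    have "p = L q"
      unfolding L_def q by (rule eq)
    moreover have "q \<in> U \<inter> Z"
      using p st by (simp add: U_def Z_def q ct_chart_def)
    ultimately show "p \<in> L ` (U \<inter> Z)" by blast
  next
    fix p assume "p \<in> L ` (U \<inter> Z)"
    then obtain q where q: "q \<in> U \<inter> Z" "p = L q" by blast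
    then have "p \<in> ct_chart \<xi>"
      by (auto simp: U_def ct_chart_def L)
    moreover have "p = q $ 1 *\<^sub>R ct_l1 \<kappa> \<xi> + q $ 4 *\<^sub>R ct_l2 \<kappa> \<xi> + ct_y p *\<^sub>R axis 2 1 + ct_x p *\<^sub>R axis 3 1"
      unfolding q(2) L by (simp add: L_def)
    ultimately show "p \<in> ct_fundamental_domain \<kappa> \<xi>"
      using q(1) unfolding ct_fundamental_domain_def U_def Z_def by blast
  qed
  moreover have "linear L"
    by (rule linearI) (simp_all add: L_def algebra_simps)
  moreover have "open U" unfolding U_def
    by (intro open_Int open_chart open_Collect_less continuous_intros)
  moreover have "closed Z" unfolding Z_def
    by (intro closed_Int closed_Collect_le continuous_intros)
  ultimately show ?thesis
    by (simp add: borel_linear_image_open_Int_closed)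
qed

lemma fundamental_domain_subset: "ct_fundamental_domain \<kappa> \<xi> \<subseteq> ct_chart \<xi>"
  by (auto simp: ct_fundamental_domain_def)

lemma fundamental_domain_bounded:
  obtains T where "\<And>p. p \<in> ct_fundamental_domain \<kappa> \<xi> \<Longrightarrow> \<bar>p $ 1\<bar> \<le> T \<and> \<bar>p $ 4\<bar> \<le> T"
proof
  define T where "T i = 2 * pi * \<bar>ct_l1 \<kappa> \<xi> $ i\<bar> + 2 * pi * \<bar>ct_l2 \<kappa> \<xi> $ i\<bar>" for i
  fix p assume "p \<in> ct_fundamental_domain \<kappa> \<xi>"
  then obtain s t where st: "0 \<le> s" "s < 2 * pi" "0 \<le> t" "t < 2 * pi"
    and eq: "p = s *\<^sub>R ct_l1 \<kappa> \<xi> + t *\<^sub>R ct_l2 \<kappa> \<xi> + ct_y p *\<^sub>R axis 2 1 + ct_x p *\<^sub>R axis 3 1"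
    unfolding ct_fundamental_domain_def by blast
  have "\<bar>p $ i\<bar> \<le> T i" if i: "i = 1 \<or> i = 4" for i
  proof -
    have "p $ i = s * ct_l1 \<kappa> \<xi> $ i + t * ct_l2 \<kappa> \<xi> $ i"
      using i by (subst eq) (auto simp: axis_def)
    also have "\<bar>\<dots>\<bar> \<le> \<bar>s\<bar> * \<bar>ct_l1 \<kappa> \<xi> $ i\<bar> + \<bar>t\<bar> * \<bar>ct_l2 \<kappa> \<xi> $ i\<bar>"
      by (metis abs_mult abs_triangle_ineq)
    also have "\<dots> \<le> T i"
      unfolding T_def using st by (intro add_mono mult_right_mono) auto
    finally show ?thesis .
  qed
  from this[of 1] this[of 4] show "\<bar>p $ 1\<bar> \<le> max (T 1) (T 4) \<and> \<bar>p $ 4\<bar> \<le> max (T 1) (T 4)"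
    by auto
qed

section \<open>The energy integral over the rectangle\<close>

text \<open>
  The functions \<open>F\<close> and \<open>H\<close> of the metric, on the plane of the coordinates \<open>(x, y)\<close> instead of
  the chart.
\<close>

definition F_xy :: "real \<times> real \<Rightarrow> real" where
  "F_xy z = (snd z)\<^sup>2 * poly (ct_P \<xi>) (fst z) - (fst z)\<^sup>2 * poly (ct_P \<xi>) (snd z)"

definition H_xy :: "real \<times> real \<Rightarrow> real" where
  "H_xy z = (\<nu> * fst z + snd z) * Q (fst z) (snd z)"

lemma ct_functions_xy:
  "ct_X \<xi> p = poly (ct_P \<xi>) (fst (xy p))" "ct_Y \<xi> p = poly (ct_P \<xi>) (snd (xy p))"
  "ct_F \<xi> p = F_xy (xy p)" "ct_H \<xi> p = H_xy (xy p)"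
  by (simp_all add: ct_X_def ct_Y_def ct_F_def ct_H_eq F_xy_def H_xy_def xy_def)

lemma continuous_on_Q [continuous_intros]:
  "continuous_on S f \<Longrightarrow> continuous_on S g \<Longrightarrow> continuous_on S (\<lambda>z. Q (f z) (g z))"
  unfolding Q_def by (intro continuous_intros)

lemma open_rect_signs:
  assumes "z \<in> open_rect"
  shows "fst z - snd z > 0" "poly (ct_P \<xi>) (fst z) < 0" "poly (ct_P \<xi>) (snd z) > 0" "F_xy z < 0" "H_xy z < 0"
proof -
  \<comment> \<open>Any point of the chart over \<open>z\<close> will do.\<close>
  define p :: "real^4" where "p = (\<chi> i. if i = 2 then snd z else fst z)"
  have p: "xy p = z" by (simp add: xy_def p_def)
  then have "p \<in> ct_chart \<xi>" using assms by (simp add: chart_iff)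
  from chart_signs[OF this] p
  show "fst z - snd z > 0" "poly (ct_P \<xi>) (fst z) < 0" "poly (ct_P \<xi>) (snd z) > 0" "F_xy z < 0" "H_xy z < 0"
    by (auto simp: ct_functions_xy) (auto simp: xy_def)
qed

text \<open>
  The product of the energy density and the volume density, for
  \<open>d\<alpha> = u dy + v dx\<close>. On the open rectangle every parenthesis is positive.
\<close>

definition energy_integrand :: "(real \<times> real \<Rightarrow> real) \<Rightarrow> (real \<times> real \<Rightarrow> real) \<Rightarrow> real \<times> real \<Rightarrow> real" where
  "energy_integrand u v z = 2 * (- H_xy z) * (poly (ct_P \<xi>) (snd z) * (u z)\<^sup>2 - poly (ct_P \<xi>) (fst z) * (v z)\<^sup>2)
     / ((- F_xy z) * (fst z - snd z))"

text \<open>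
  Compactness bounds \<open>-H\<close>, \<open>u\<^sup>2\<close> and \<open>v\<^sup>2\<close> by some \<open>B\<close>. Both the numerator and
  \<open>-F\<close> degenerate where \<open>X\<close> or \<open>Y\<close> vanishes, but their quotient is at most \<open>B / x\<^sub>3\<^sup>2\<close>, because
  \<open>-F\<close> dominates \<open>x\<^sub>3\<^sup>2 (Y - X)\<close>. What remains is \<open>1 / (x - y)\<close>, with \<open>x - y = (x - x\<^sub>2) + (x\<^sub>2 - y)\<close>;
  the bound by inverse square roots splits it into functions of one variable.
\<close>

lemma energy_integrand_bound:
  assumes "continuous_on rect u" "continuous_on rect v"
  obtains C where "C \<ge> 0" "\<And>z. z \<in> open_rect \<Longrightarrow>
    \<bar>energy_integrand u v z\<bar> \<le> C * (1 / sqrt (x\<^sub>2 - snd z) * (1 / sqrt (fst z - x\<^sub>2)))"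
proof -
  have "compact ((\<lambda>z. (H_xy z, (u z)\<^sup>2 + (v z)\<^sup>2)) ` rect)"
    unfolding H_xy_def using assms by (intro compact_continuous_image continuous_intros compact_rect)
  then obtain B where B: "\<And>z. z \<in> rect \<Longrightarrow> norm (H_xy z, (u z)\<^sup>2 + (v z)\<^sup>2) \<le> B"
    by (meson bounded_iff compact_imp_bounded imageI)
  define C where "C = 2 * B * (B / x\<^sub>3\<^sup>2)"
  have bound: "\<bar>energy_integrand u v z\<bar> \<le> C * (1 / sqrt (x\<^sub>2 - snd z) * (1 / sqrt (fst z - x\<^sub>2)))"
    and "C \<ge> 0" if z: "z \<in> open_rect" for z
  proof -
    have zr: "x\<^sub>2 < fst z" "fst z < x\<^sub>3" "x\<^sub>1 < snd z" "snd z < x\<^sub>2"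
      using z by (auto simp: open_rect_def)
    define X Y where "X = - poly (ct_P \<xi>) (fst z)" and "Y = poly (ct_P \<xi>) (snd z)"
    note sgn = open_rect_signs[OF z, folded Y_def]
    have X: "X > 0" using sgn by (simp add: X_def)
    have "norm (H_xy z, (u z)\<^sup>2 + (v z)\<^sup>2) \<le> B"
      using B z open_rect_subset by blast
    then have HB: "- H_xy z \<le> B" and uv: "(u z)\<^sup>2 + (v z)\<^sup>2 \<le> B"
      using norm_fst_le[of "H_xy z" "(u z)\<^sup>2 + (v z)\<^sup>2"] norm_snd_le[of "(u z)\<^sup>2 + (v z)\<^sup>2" "H_xy z"] by auto
    have B0: "B \<ge> 0" using sgn HB by linarith
    have x3: "x\<^sub>3\<^sup>2 > 0" using roots_ordered by simp
    show "C \<ge> 0" using B0 by (simp add: C_def)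
    have sq: "(u z)\<^sup>2 \<le> B" "(v z)\<^sup>2 \<le> B"
      using uv zero_le_power2[of "u z"] zero_le_power2[of "v z"] by linarith+
    have "x\<^sub>3\<^sup>2 \<le> (fst z)\<^sup>2" "x\<^sub>3\<^sup>2 \<le> (snd z)\<^sup>2"
      using zr roots_ordered by (auto simp: abs_le_square_iff[symmetric])
    then have "x\<^sub>3\<^sup>2 * X + x\<^sub>3\<^sup>2 * Y \<le> (snd z)\<^sup>2 * X + (fst z)\<^sup>2 * Y"
      using X sgn by (intro add_mono mult_right_mono) auto
    then have F: "x\<^sub>3\<^sup>2 * (X + Y) \<le> - F_xy z"
      by (simp add: F_xy_def X_def Y_def algebra_simps)
    have "Y * (u z)\<^sup>2 + X * (v z)\<^sup>2 \<le> Y * B + X * B"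
      using X sgn sq by (intro add_mono mult_left_mono) auto
    also have "\<dots> = B / x\<^sub>3\<^sup>2 * (x\<^sub>3\<^sup>2 * (X + Y))"
      using x3 by (simp add: field_simps)
    also have "\<dots> \<le> B / x\<^sub>3\<^sup>2 * (- F_xy z)"
      using F B0 by (intro mult_left_mono) auto
    finally have N: "(Y * (u z)\<^sup>2 + X * (v z)\<^sup>2) / (- F_xy z) \<le> B / x\<^sub>3\<^sup>2"
      using sgn by (simp add: field_simps)
    have N0: "(Y * (u z)\<^sup>2 + X * (v z)\<^sup>2) / (- F_xy z) \<ge> 0"
      using sgn X by (intro divide_nonneg_nonneg add_nonneg_nonneg mult_nonneg_nonneg) auto
    have eq: "energy_integrand u v z
        = 2 * (- H_xy z) * ((Y * (u z)\<^sup>2 + X * (v z)\<^sup>2) / (- F_xy z)) * (1 / (fst z - snd z))"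
      by (simp add: energy_integrand_def X_def Y_def)
    have "\<bar>energy_integrand u v z\<bar> = energy_integrand u v z"
      unfolding eq using sgn N0 by (intro abs_of_nonneg mult_nonneg_nonneg) auto
    also have "\<dots> \<le> C * (1 / (fst z - snd z))"
      unfolding eq C_def using sgn N N0 HB B0 by (intro mult_right_mono mult_mono) auto
    also have "\<dots> \<le> C * (1 / sqrt (x\<^sub>2 - snd z) * (1 / sqrt (fst z - x\<^sub>2)))"
      using inverse_sum_le_inverse_sqrt[of "x\<^sub>2 - snd z" "fst z - x\<^sub>2"] zr \<open>C \<ge> 0\<close>
      by (intro mult_left_mono) auto
    finally show "\<bar>energy_integrand u v z\<bar> \<le> C * (1 / sqrt (x\<^sub>2 - snd z) * (1 / sqrt (fst z - x\<^sub>2)))" .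
  qed
  \<comment> \<open>The sign of \<open>C\<close> is read off at the midpoint of the rectangle.\<close>
  have "((x\<^sub>2 + x\<^sub>3) / 2, (x\<^sub>1 + x\<^sub>2) / 2) \<in> open_rect"
    using roots_ordered by (auto simp: open_rect_def)
  from \<open>\<And>z. z \<in> open_rect \<Longrightarrow> C \<ge> 0\<close>[OF this] bound show ?thesis
    by (rule that)
qed

lemma integrable_energy_integrand:
  assumes uv: "continuous_on rect u" "continuous_on rect v"
  shows "integrable lborel
    (\<lambda>p. indicator (ct_fundamental_domain \<kappa> \<xi>) p *\<^sub>R energy_integrand u v (xy p))"
proof -
  define FD where "FD = ct_fundamental_domain \<kappa> \<xi>"
  obtain C where C: "C \<ge> 0" "\<And>z. z \<in> open_rect \<Longrightarrow>
    \<bar>energy_integrand u v z\<bar> \<le> C * (1 / sqrt (x\<^sub>2 - snd z) * (1 / sqrt (fst z - x\<^sub>2)))"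
    using energy_integrand_bound[OF uv] by blast
  obtain T where T: "\<And>p. p \<in> FD \<Longrightarrow> \<bar>p $ 1\<bar> \<le> T \<and> \<bar>p $ 4\<bar> \<le> T"
    using fundamental_domain_bounded unfolding FD_def by blast
  define g :: "4 \<Rightarrow> real \<Rightarrow> real" where "g i =
    (if i = 2 then (\<lambda>t. indicator {x\<^sub>1..x\<^sub>2} t / sqrt (x\<^sub>2 - t))
     else if i = 3 then (\<lambda>t. indicator {x\<^sub>2..x\<^sub>3} t / sqrt (t - x\<^sub>2))
     else indicator {-T..T})" for i
  have "integrable lborel (\<lambda>p :: real^4. g 1 (p $ 1) * g 2 (p $ 2) * g 3 (p $ 3) * g 4 (p $ 4))"
  proof (rule integrable_lborel_vec4_prod)
    fix i
    show "g i \<in> borel_measurable borel" by (simp add: g_def)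
    show "0 \<le> g i t" for t
      using roots_ordered by (auto simp: g_def indicator_def)
    show "(\<integral>\<^sup>+t. ennreal (g i t) \<partial>lborel) < \<infinity>"
      using nn_integral_inverse_sqrt[of x\<^sub>1 x\<^sub>2] nn_integral_inverse_sqrt[of x\<^sub>2 x\<^sub>3] roots_ordered
      by (auto simp: g_def ennreal_indicator emeasure_lborel_Icc_eq)
  qed
  then have G: "integrable lborel (\<lambda>p :: real^4. C * (g 1 (p $ 1) * g 2 (p $ 2) * g 3 (p $ 3) * g 4 (p $ 4)))"
    by simp
  have FD: "FD \<in> sets borel" "FD \<subseteq> ct_chart \<xi>"
    using fundamental_domain_borel fundamental_domain_subset by (auto simp: FD_def)
  have "continuous_on (ct_chart \<xi>) (\<lambda>p. energy_integrand u v (xy p))"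
  proof (rule continuous_on_compose2[OF _ continuous_on_xy])
    show "xy ` ct_chart \<xi> \<subseteq> open_rect" by (auto simp: chart_iff)
    show "continuous_on open_rect (energy_integrand u v)"
      unfolding energy_integrand_def F_xy_def H_xy_def
      using open_rect_signs[unfolded F_xy_def]
      by (intro continuous_intros uv[THEN continuous_on_subset, OF open_rect_subset]) force
  qed
  then have "continuous_on FD (\<lambda>p. energy_integrand u v (xy p))"
    using FD(2) by (rule continuous_on_subset)
  from borel_measurable_continuous_on_indicator[OF FD(1) this]
  have meas: "(\<lambda>p. indicator FD p *\<^sub>R energy_integrand u v (xy p)) \<in> borel_measurable lborel"
    by simp
  show ?thesis
    unfolding FD_def[symmetric]
  proof (rule Bochner_Integration.integrable_bound[OF G meas], rule AE_I2)
    fix p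
    show "norm (indicator FD p *\<^sub>R energy_integrand u v (xy p))
      \<le> norm (C * (g 1 (p $ 1) * g 2 (p $ 2) * g 3 (p $ 3) * g 4 (p $ 4)))"
    proof (cases "p \<in> FD")
      case True
      then have z: "xy p \<in> open_rect" using FD chart_iff by blast
      have "C * (g 1 (p $ 1) * g 2 (p $ 2) * g 3 (p $ 3) * g 4 (p $ 4))
          = C * (1 / sqrt (x\<^sub>2 - snd (xy p)) * (1 / sqrt (fst (xy p) - x\<^sub>2)))"
        using T[OF True] z by (auto simp: g_def open_rect_def xy_def indicator_def)
      with C(2)[OF z] have "\<bar>energy_integrand u v (xy p)\<bar>
          \<le> C * (g 1 (p $ 1) * g 2 (p $ 2) * g 3 (p $ 3) * g 4 (p $ 4))"
        by simp
      also have "\<dots> \<le> \<bar>\<dots>\<bar>" by (rule abs_ge_self)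
      finally show ?thesis using True by simp
    qed simp
  qed
qed

section \<open>Finite energy\<close>

text \<open>
  Bounded partial derivatives suffice for finite energy, whatever the duality of the form.
  Boundedness comes from continuity up to the compact boundary, in particular at the corner
  that represents infinity.
\<close>

lemma finite_energy_if_differential_bounded:
  assumes uv: "continuous_on rect u" "continuous_on rect v"
    and \<alpha>: "\<And>p. p \<in> ct_chart \<xi> \<Longrightarrow> differential \<alpha> p = u (xy p) *\<^sub>R d_y + v (xy p) *\<^sub>R d_x"
    and \<omega>: "\<omega> = ct_sd_form \<kappa> \<xi> \<alpha> \<or> \<omega> = ct_asd_form \<kappa> \<xi> \<alpha>"
  shows "ct_finite_energy \<kappa> \<xi> \<omega>"
proof -
  define FD where "FD = ct_fundamental_domain \<kappa> \<xi>"
  define e where "e z = 2 * (fst z - snd z) ^ 4 * (poly (ct_P \<xi>) (fst z) * (v z)\<^sup>2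
    - poly (ct_P \<xi>) (snd z) * (u z)\<^sup>2) / (\<kappa> * F_xy z)" for z
  define dens where "dens p = wedge_2_2 (\<omega> p) (hodge_star (ct_metric \<kappa> \<xi> p) (\<omega> p))
    / volume_form (ct_metric \<kappa> \<xi> p)" for p
  define vol where "vol p = volume_form (ct_metric \<kappa> \<xi> p)" for p
  define \<Sigma> where "\<Sigma> = sigma (ct_M \<kappa> \<xi>) (ct_open_sets \<kappa> \<xi>)"
  define N where "N = restrict_space (lborel :: (real^4) measure) FD"
  have FD: "FD \<in> sets borel" "FD \<subseteq> ct_chart \<xi>"
    using fundamental_domain_borel fundamental_domain_subset by (auto simp: FD_def)
  have space_N: "space N = FD" by (simp add: N_def space_restrict_space)
  have dens: "dens p = e (xy p)" if "p \<in> ct_chart \<xi>" for p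
    unfolding dens_def e_def energy_density_ct_form[OF that \<alpha>[OF that] \<omega>] ct_functions_xy
    by (simp add: xy_def)
  have "continuous_on open_rect e"
    unfolding e_def F_xy_def using open_rect_signs(4)[unfolded F_xy_def] kappa_pos
    by (intro continuous_intros uv[THEN continuous_on_subset, OF open_rect_subset]) force
  then have E: "ct_descend \<xi> dens \<in> borel_measurable \<Sigma>"
    unfolding \<Sigma>_def by (intro measurable_ct_descend[of dens e, OF dens])
  have proj: "ct_proj \<kappa> \<xi> \<in> N \<rightarrow>\<^sub>M \<Sigma>"
    unfolding \<Sigma>_def N_def using FD(2) chart_subset_region by (intro measurable_ct_proj) auto
  have vol: "vol \<in> borel_measurable N"
  proof -
    have "continuous_on FD (\<lambda>p. \<kappa> * (- ct_H \<xi> p) / (ct_x p - ct_y p) ^ 5)"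
      unfolding ct_H_eq using chart_signs(1) FD(2) by (intro continuous_intros) force
    then have "(\<lambda>p. \<kappa> * (- ct_H \<xi> p) / (ct_x p - ct_y p) ^ 5) \<in> borel_measurable (restrict_space borel FD)"
      by (rule borel_measurable_continuous_on_restrict)
    also have "borel_measurable (restrict_space borel FD) = borel_measurable N"
      unfolding N_def by (intro measurable_cong_sets sets_restrict_space_cong) auto
    finally have "(\<lambda>p. \<kappa> * (- ct_H \<xi> p) / (ct_x p - ct_y p) ^ 5) \<in> borel_measurable N" .
    moreover have "vol p = \<kappa> * (- ct_H \<xi> p) / (ct_x p - ct_y p) ^ 5" if "p \<in> space N" for p
      unfolding vol_def using that FD(2) by (intro volume_form_ct_metric) (auto simp: space_N)
    ultimately show ?thesis
      by (simp only: measurable_cong[of N vol "\<lambda>p. \<kappa> * (- ct_H \<xi> p) / (ct_x p - ct_y p) ^ 5"])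
  qed
  have vol_nonneg: "vol p \<ge> 0" if "p \<in> FD" for p
  proof -
    have p: "p \<in> ct_chart \<xi>" using that FD(2) by blast
    show ?thesis
      unfolding vol_def volume_form_ct_metric[OF p] using chart_signs[OF p] kappa_pos
      by (intro divide_nonneg_nonneg mult_nonneg_nonneg) auto
  qed
  have integrand: "vol p * ct_descend \<xi> dens (ct_proj \<kappa> \<xi> p) = energy_integrand u v (xy p)"
    if "p \<in> FD" for p
  proof -
    have p: "p \<in> ct_chart \<xi>" "p \<in> ct_region \<xi>"
      using that FD(2) chart_subset_region by auto
    then have z: "xy p \<in> open_rect" by (simp add: chart_iff)
    have "ct_descend \<xi> dens (ct_proj \<kappa> \<xi> p) = e (xy p)"
      by (subst ct_descend_eq[of dens e, OF dens ct_proj_in_M[OF p(2)]])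
        (use z in \<open>simp_all add: xy_M_ct_proj[OF p(2)]\<close>)
    moreover have "vol p = \<kappa> * (- H_xy (xy p)) / (fst (xy p) - snd (xy p)) ^ 5"
      unfolding vol_def volume_form_ct_metric[OF p(1)] ct_functions_xy by (simp add: xy_def)
    moreover have "\<kappa> * (- H) / d ^ 5 * (2 * d ^ 4 * (X * b\<^sup>2 - Y * a\<^sup>2) / (\<kappa> * F))
        = 2 * (- H) * (Y * a\<^sup>2 - X * b\<^sup>2) / ((- F) * d)" if "d > 0" "F < 0" for a b d F H X Y :: real
      using that kappa_pos by (simp add: field_simps eval_nat_numeral)
    note this[OF open_rect_signs(1)[OF z] open_rect_signs(4)[OF z]]
    ultimately show ?thesis
      unfolding e_def energy_integrand_def by (simp only:)
  qed
  have "integrable N (\<lambda>p. vol p *\<^sub>R ct_descend \<xi> dens (ct_proj \<kappa> \<xi> p))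
      \<longleftrightarrow> integrable N (\<lambda>p. energy_integrand u v (xy p))"
    by (rule Bochner_Integration.integrable_cong) (auto simp: space_N integrand)
  also have "\<dots>"
    unfolding N_def using FD integrable_energy_integrand[OF uv, folded FD_def]
    by (subst integrable_restrict_space) auto
  finally have "integrable (density N (\<lambda>p. ennreal (vol p))) (\<lambda>p. ct_descend \<xi> dens (ct_proj \<kappa> \<xi> p))"
    using vol_nonneg
    by (subst integrable_density) (auto intro!: AE_I2 vol measurable_compose[OF proj E] simp: space_N)
  then have "integrable (distr (density N (\<lambda>p. ennreal (vol p))) \<Sigma> (ct_proj \<kappa> \<xi>)) (ct_descend \<xi> dens)"
    using proj E by (subst integrable_distr_eq) auto
  then show ?thesis
    unfolding ct_finite_energy_def ct_volume_def ct_energy_density_def dens_def vol_def N_def \<Sigma>_def FD_def .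
qed

text \<open>
  The quotient rule. That \<open>D\<close> has no zero on the closed rectangle, with the corner at infinity
  included, is what extends the partial derivatives of \<open>\<alpha>\<close> continuously to the boundary.
\<close>

lemma finite_energy_quotient:
  fixes N D N\<^sub>x N\<^sub>y D\<^sub>x D\<^sub>y :: "real \<times> real \<Rightarrow> real"
  assumes cont: "continuous_on rect N" "continuous_on rect N\<^sub>x" "continuous_on rect N\<^sub>y"
      "continuous_on rect D" "continuous_on rect D\<^sub>x" "continuous_on rect D\<^sub>y"
    and N: "\<And>z. (N has_derivative (\<lambda>h. N\<^sub>x z * fst h + N\<^sub>y z * snd h)) (at z)"
    and D: "\<And>z. (D has_derivative (\<lambda>h. D\<^sub>x z * fst h + D\<^sub>y z * snd h)) (at z)"
    and nz: "\<And>z. z \<in> rect \<Longrightarrow> D z \<noteq> 0"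
    and \<alpha>: "\<And>p. p \<in> ct_chart \<xi> \<Longrightarrow> \<alpha> p = N (xy p) / D (xy p)"
    and \<omega>: "\<omega> = ct_sd_form \<kappa> \<xi> \<alpha> \<or> \<omega> = ct_asd_form \<kappa> \<xi> \<alpha>"
  shows "ct_finite_energy \<kappa> \<xi> \<omega>"
proof (rule finite_energy_if_differential_bounded[OF _ _ _ \<omega>])
  define u v where "u z = (N\<^sub>y z * D z - N z * D\<^sub>y z) / (D z * D z)"
    and "v z = (N\<^sub>x z * D z - N z * D\<^sub>x z) / (D z * D z)" for z
  show "continuous_on rect u" "continuous_on rect v"
    unfolding u_def v_def using nz by (auto intro!: continuous_intros cont)
  fix p assume p: "p \<in> ct_chart \<xi>"
  have nzp: "D (xy p) \<noteq> 0"
    using p nz chart_iff open_rect_subset by blast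
  have xy: "(xy has_derivative (\<lambda>h. (h $ 3, h $ 2))) (at p)"
    unfolding xy_def
    by (intro bounded_linear_imp_has_derivative bounded_linear_Pair bounded_linear_vec_nth)
  have "((\<lambda>p. N (xy p) / D (xy p)) has_derivative (\<lambda>h. u (xy p) * h $ 2 + v (xy p) * h $ 3)) (at p)"
    by (rule has_derivative_eq_rhs[OF has_derivative_divide'[OF has_derivative_compose[OF xy N]
          has_derivative_compose[OF xy D] nzp]])
      (use nzp in \<open>simp add: u_def v_def fun_eq_iff field_simps\<close>)
  from has_derivative_transform_within_open[OF this open_chart p] \<alpha>
  have "(\<alpha> has_derivative (\<lambda>h. u (xy p) * h $ 2 + v (xy p) * h $ 3)) (at p)"
    by simp
  then show "differential \<alpha> p = u (xy p) *\<^sub>R d_y + v (xy p) *\<^sub>R d_x"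
    by (rule differential_eqI)
qed

section \<open>The three forms\<close>

lemma rect_signs:
  assumes "z \<in> rect"
  shows "\<nu> * fst z + snd z \<noteq> 0" "Q (fst z) (snd z) \<noteq> 0"
  using assms nu_x_plus_y_neg[of "fst z" "snd z"] Q_pos[of "fst z" "snd z"] by (auto simp: rect_def)

lemma Q_has_derivative:
  "((\<lambda>z. (\<nu> - 1) * Q (fst z) (snd z)) has_derivative
    (\<lambda>h. (\<nu> - 1) * (\<nu> * (ct_a \<xi> 1 - fst z * snd z) - (\<nu> * fst z - snd z) * snd z) * fst h
       + (\<nu> - 1) * (- (ct_a \<xi> 1 - fst z * snd z) - (\<nu> * fst z - snd z) * fst z) * snd h)) (at z)"
  unfolding Q_def by (auto intro!: derivative_eq_intros simp: algebra_simps)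

lemma finite_energy_omega_plus: "ct_finite_energy \<kappa> \<xi> (ct_omega_plus \<kappa> \<xi>)"
proof (rule finite_energy_quotient)
  show "ct_omega_plus \<kappa> \<xi> = ct_sd_form \<kappa> \<xi> (ct_alpha_plus \<xi>)
      \<or> ct_omega_plus \<kappa> \<xi> = ct_asd_form \<kappa> \<xi> (ct_alpha_plus \<xi>)"
    by (simp add: ct_omega_plus_def)
  show "ct_alpha_plus \<xi> p = (\<lambda>z. - (fst z + snd z)) (xy p) / (\<lambda>z. (\<nu> - 1) * (\<nu> * fst z + snd z)) (xy p)" for p
    by (simp add: ct_alpha_plus_def xy_def)
  show "((\<lambda>z. - (fst z + snd z)) has_derivative (\<lambda>h. (\<lambda>z. - 1) z * fst h + (\<lambda>z. - 1) z * snd h)) (at z)"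
    for z :: "real \<times> real"
    by (auto intro!: derivative_eq_intros)
  show "((\<lambda>z. (\<nu> - 1) * (\<nu> * fst z + snd z)) has_derivative
      (\<lambda>h. (\<lambda>z. (\<nu> - 1) * \<nu>) z * fst h + (\<lambda>z. \<nu> - 1) z * snd h)) (at z)"
    for z :: "real \<times> real"
    by (auto intro!: derivative_eq_intros simp: algebra_simps)
  show "(\<nu> - 1) * (\<nu> * fst z + snd z) \<noteq> 0" if "z \<in> rect" for z
    using rect_signs[OF that] nu_bounds by simp
qed (intro continuous_intros)+

text \<open>
  The factor \<open>\<nu> x + y\<close> of the numerator cancels against the same factor of \<open>H\<close>, here and in
  \<open>\<alpha>\<^sub>2\<close>, and leaves the denominator \<open>(\<nu> - 1) Q\<close>.
\<close>

lemma finite_energy_omega_minus: "ct_finite_energy \<kappa> \<xi> (ct_omega_minus \<kappa> \<xi>)"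
proof (rule finite_energy_quotient[OF _ _ _ _ _ _ _ Q_has_derivative])
  show "ct_omega_minus \<kappa> \<xi> = ct_sd_form \<kappa> \<xi> (ct_alpha_minus \<xi>)
      \<or> ct_omega_minus \<kappa> \<xi> = ct_asd_form \<kappa> \<xi> (ct_alpha_minus \<xi>)"
    by (simp add: ct_omega_minus_def)
  show "ct_alpha_minus \<xi> p = (\<lambda>z. (fst z - snd z) * (ct_a \<xi> 1 - fst z * snd z)) (xy p)
      / ((\<nu> - 1) * Q (fst (xy p)) (snd (xy p)))" if "p \<in> ct_chart \<xi>" for p
    using rect_signs(1)[of "xy p"] that open_rect_subset
    by (auto simp: ct_alpha_minus_def ct_H_eq xy_def chart_iff coeff_P(4))
  show "((\<lambda>z. (fst z - snd z) * (ct_a \<xi> 1 - fst z * snd z)) has_derivative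
      (\<lambda>h. (\<lambda>z. (ct_a \<xi> 1 - fst z * snd z) - (fst z - snd z) * snd z) z * fst h
        + (\<lambda>z. - (ct_a \<xi> 1 - fst z * snd z) - (fst z - snd z) * fst z) z * snd h)) (at z)"
    for z :: "real \<times> real"
    by (auto intro!: derivative_eq_intros simp: algebra_simps)
  show "(\<nu> - 1) * Q (fst z) (snd z) \<noteq> 0" if "z \<in> rect" for z
    using rect_signs[OF that] nu_bounds by simp
qed (intro continuous_intros)+

lemma finite_energy_omega_two: "ct_finite_energy \<kappa> \<xi> (ct_omega_two \<kappa> \<xi>)"
proof (rule finite_energy_quotient[OF _ _ _ _ _ _ _ Q_has_derivative])
  show "ct_omega_two \<kappa> \<xi> = ct_sd_form \<kappa> \<xi> (ct_alpha_two \<xi>)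
      \<or> ct_omega_two \<kappa> \<xi> = ct_asd_form \<kappa> \<xi> (ct_alpha_two \<xi>)"
    by (simp add: ct_omega_two_def)
  show "ct_alpha_two \<xi> p = (\<lambda>z. fst z - snd z) (xy p)
      / ((\<nu> - 1) * Q (fst (xy p)) (snd (xy p)))" if "p \<in> ct_chart \<xi>" for p
    using rect_signs(1)[of "xy p"] that open_rect_subset
    by (auto simp: ct_alpha_two_def ct_H_eq xy_def chart_iff)
  show "((\<lambda>z. fst z - snd z) has_derivative (\<lambda>h. (\<lambda>z. 1) z * fst h + (\<lambda>z. - 1) z * snd h)) (at z)"
    for z :: "real \<times> real"
    by (auto intro!: derivative_eq_intros)
  show "(\<nu> - 1) * Q (fst z) (snd z) \<noteq> 0" if "z \<in> rect" for z
    using rect_signs[OF that] nu_bounds by simp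
qed (intro continuous_intros)+

end

theorem proposition4p1:
  fixes \<kappa> \<xi> :: real
  assumes "\<kappa> > 0" and "1 / 2 < \<xi>" and "\<xi> < 1 / sqrt 2"
  shows "\<forall>\<omega> \<in> {ct_omega_plus \<kappa> \<xi>, ct_omega_minus \<kappa> \<xi>, ct_omega_two \<kappa> \<xi>}.
           ct_finite_energy \<kappa> \<xi> \<omega>"
proof -
  interpret chen_teo \<kappa> \<xi>
    using assms by unfold_locales
  show ?thesis
    using finite_energy_omega_plus finite_energy_omega_minus finite_energy_omega_two by blast
qed

end
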